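(* Suppose that the Markov kernel $P$ is reversible with respect to its stationary distribution $\pi$, and that $$\int_{y}d(x,y)\,\kappa_{\Sigma}^c(x,y)\,\mathrm{d}P_x(y)<\infty\quad\text{for }\pi\text{-almost every }x\in\Omega.$$ Let $f:\Omega\to\mathbb{R}$ be $1$-Lipschitz and let $X\sim\pi$. (i) For every $t\ge0$, $$\mathbb{P}_{\pi}(|f(X)-\mathbb{E}_{\pi}(f)|\ge t)\le 2\exp\left(-\frac{t^2}{\kappa_{\Sigma}^c\,\hat\sigma_{\max}^2}\right).$$ (ii) Let $V:\Omega\to[0,\infty)$ be a Lipschitz function such that for every $x\in\Omega$ $$\int\kappa_{\Sigma}^c(x,y)\,d(x,y)^2\,\mathrm{d}P_x(y)\le V(x),$$ and let $L:=8\,\mathbb{E}_{\pi}(V)/(\|V\|_{\mathrm{Lip}}^2\,\hat\sigma_{\max}^2\,\kappa_{\Sigma}^c)$, where $\|V\|_{\mathrm{Lip}}$ is the Lipschitz coefficient of $V$. Then for any $t\ge0$, $$\mathbb{P}_{\pi}(|f(X)-\mathbb{E}_{\pi}(f)|\ge t)\le 2\exp\left(-\frac{t^2}{4\,\mathbb{E}_{\pi}(V)+4L^{-1/2}\cdot t}\right).$$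
   Context: $(\Omega,d)$ is a Polish metric space with at least two points and $P(x,\mathrm{d}y)$ is a Markov kernel on $\Omega$, measurable in $x$, with stationary distribution $\pi$; $P_x=P(x,\cdot)$, and $W_1(\delta_x,P_x)<\infty$ for every $x$. $P^k_x$ is the $k$-step kernel, $P^0_x=\delta_x$. $W_1(\mu_1,\mu_2)=\inf\mathbb{E}(d(X,Y))$ over all couplings $(X,Y)$ of $\mu_1,\mu_2$. Multi-step coarse Ricci curvature: $\kappa_k(x,y)=1-W_1(P^k_x,P^k_y)/d(x,y)$ for $x\ne y$, $\kappa_k(x,x)=1$, $\kappa_k=\inf_{x,y\in\Omega}\kappa_k(x,y)$. Define $\kappa_\Sigma^c(x,y)=\sum_{k=0}^\infty(1-\kappa_k(x,y))$ and $\kappa_\Sigma^c=\sum_{k=0}^\infty(1-\kappa_k)$. Mean square jump length at $x$: $\hat\sigma(x)=\left(\int d(x,y)^2\,\mathrm{d}P_x(y)\right)^{1/2}$; $\hat\sigma_{\max}=\sup_{x\in\Omega}\hat\sigma(x)$. Conventions: if $\kappa_\Sigma^c=\infty$ or $\hat\sigma_{\max}=\infty$ the bounds are read as trivial; if $\|V\|_{\mathrm{Lip}}=0$ then $L=+\infty$ and $L^{-1/2}=0$; if $L=0$ then $L^{-1/2}=+\infty$ and the second bound is trivial. *)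

theory Defs
  imports "HOL-Probability.Probability"
begin

definition stationary :: "('a::polish_space \<Rightarrow> 'a measure) \<Rightarrow> 'a measure \<Rightarrow> bool" where
  "stationary P \<pi> \<longleftrightarrow> \<pi> \<in> space (prob_algebra borel) \<and> \<pi> \<bind> P = \<pi>"

definition reversible :: "('a::polish_space \<Rightarrow> 'a measure) \<Rightarrow> 'a measure \<Rightarrow> bool" where
  "reversible P \<pi> \<longleftrightarrow> (\<forall>A\<in>sets borel. \<forall>B\<in>sets borel.
     (\<integral>\<^sup>+x\<in>A. emeasure (P x) B \<partial>\<pi>) = (\<integral>\<^sup>+x\<in>B. emeasure (P x) A \<partial>\<pi>))"

primrec kernel_pow :: "('a::polish_space \<Rightarrow> 'a measure) \<Rightarrow> nat \<Rightarrow> 'a \<Rightarrow> 'a measure" where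
  "kernel_pow P 0 = return borel"
| "kernel_pow P (Suc k) = (\<lambda>x. kernel_pow P k x \<bind> P)"

definition couplings :: "'a::polish_space measure \<Rightarrow> 'a measure \<Rightarrow> ('a \<times> 'a) measure set" where
  "couplings \<mu> \<nu> = {\<gamma>. sets \<gamma> = sets (borel \<Otimes>\<^sub>M borel) \<and> distr \<gamma> borel fst = \<mu> \<and> distr \<gamma> borel snd = \<nu>}"

definition W1 :: "'a::polish_space measure \<Rightarrow> 'a measure \<Rightarrow> ennreal" where
  "W1 \<mu> \<nu> = (INF \<gamma>\<in>couplings \<mu> \<nu>. \<integral>\<^sup>+p. ennreal (dist (fst p) (snd p)) \<partial>\<gamma>)"

text \<open>The curvatures take values in \<open>[-\<infinity>, 1]\<close>, because \<open>W1\<close> may be infinite and the infimum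
  unbounded below.\<close>

definition curv_at :: "('a::polish_space \<Rightarrow> 'a measure) \<Rightarrow> nat \<Rightarrow> 'a \<Rightarrow> 'a \<Rightarrow> ereal" where
  "curv_at P k x y = (if x = y then 1
     else 1 - enn2ereal (W1 (kernel_pow P k x) (kernel_pow P k y)) / ereal (dist x y))"

definition curv :: "('a::polish_space \<Rightarrow> 'a measure) \<Rightarrow> nat \<Rightarrow> ereal" where
  "curv P k = (INF x. INF y. curv_at P k x y)"

text \<open>All the terms below are nonnegative, so \<open>e2ennreal\<close> does not truncate.\<close>

definition curv_sum_at :: "('a::polish_space \<Rightarrow> 'a measure) \<Rightarrow> 'a \<Rightarrow> 'a \<Rightarrow> ennreal" where
  "curv_sum_at P x y = (\<Sum>k. e2ennreal (1 - curv_at P k x y))"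

definition curv_sum :: "('a::polish_space \<Rightarrow> 'a measure) \<Rightarrow> ennreal" where
  "curv_sum P = (\<Sum>k. e2ennreal (1 - curv P k))"

definition jump :: "('a::polish_space \<Rightarrow> 'a measure) \<Rightarrow> 'a \<Rightarrow> ennreal" where
  "jump P x = (let I = \<integral>\<^sup>+y. ennreal ((dist x y)\<^sup>2) \<partial>P x
     in if I = \<infinity> then \<infinity> else ennreal (sqrt (enn2real I)))"

definition jump_max :: "('a::polish_space \<Rightarrow> 'a measure) \<Rightarrow> ennreal" where
  "jump_max P = (SUP x. jump P x)"

text \<open>Meaningful for Lipschitz \<open>V\<close> on a space with at least two points (nonempty, bounded supremum).\<close>

definition lip_coeff :: "('a::metric_space \<Rightarrow> real) \<Rightarrow> real" where
  "lip_coeff V = (SUP (x, y)\<in>{(x, y). x \<noteq> y}. \<bar>V x - V y\<bar> / dist x y)"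

text \<open>Used only when \<open>curv_sum P\<close> and \<open>jump_max P\<close> are finite.\<close>

definition L_const :: "('a::polish_space \<Rightarrow> 'a measure) \<Rightarrow> 'a measure \<Rightarrow> ('a \<Rightarrow> real) \<Rightarrow> ereal" where
  "L_const P \<pi> V = (if lip_coeff V = 0 then \<infinity>
     else ereal (8 * (\<integral>x. V x \<partial>\<pi>)
       / ((lip_coeff V)\<^sup>2 * (enn2real (jump_max P))\<^sup>2 * enn2real (curv_sum P))))"

text \<open>The value \<open>L\<^sup>-\<^sup>1\<^sup>/\<^sup>2\<close>, for \<open>L \<in> (0, \<infinity>]\<close>.\<close>

definition inv_sqrt :: "ereal \<Rightarrow> real" where
  "inv_sqrt L = (if L = \<infinity> then 0 else real_of_ereal L powr (-1/2))"

end

theory Submission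
  imports Defs
begin

text \<open>
  For bounded centred \<open>g\<close>, the sum \<open>h\<close> of \<open>P\<^sup>k g\<close> over \<open>k < n\<close> satisfies \<open>h - P h = g - P\<^sup>n g\<close>, and
  \<open>\<bar>h x - h y\<bar> \<le> \<kappa>\<^sub>\<Sigma>\<^sup>c(x, y) d(x, y)\<close>. Reversibility writes \<open>E((h - P h) exp (\<theta> g))\<close> as half the
  expectation of \<open>(h X - h Y) (exp (\<theta> g X) - exp (\<theta> g Y))\<close> over a stationary step \<open>(X, Y)\<close> (Chatterjee's
  exchangeable pairs); letting \<open>n \<rightarrow> \<infinity>\<close> gives \<open>m'(\<theta>) \<le> \<theta>/2 E(V exp (\<theta> g))\<close> for
  \<open>m(\<theta>) = E(exp (\<theta> g))\<close>. With \<open>V\<close> constant this integrates to (i). For (ii), Gibbs' variational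
  inequality bounds \<open>L E(V exp (\<theta> g)) / m\<close> by \<open>ln E(exp (L V)) + \<theta> m'/m - ln m\<close>, where
  \<open>ln E(exp (L V)) \<le> 3 L E(V)\<close> by (i) applied to \<open>V\<close>; hence \<open>m' \<le> 2 E(V) \<theta> m\<close> whenever
  \<open>4 \<theta>\<^sup>2 \<le> L\<close>.
\<close>

section \<open>Moment generating functions\<close>

lemma abs_exp_taylor_le:
  fixes x :: real
  assumes "\<bar>x\<bar> \<le> 1"
  shows "\<bar>exp x - 1 - x\<bar> \<le> x\<^sup>2"
proof (cases "0 \<le> x")
  case True
  then have "exp x \<le> 1 + x + x\<^sup>2" using exp_bound[of x] assms by simp
  then show ?thesis using exp_ge_add_one_self[of x] zero_le_power2[of x] by linarith
next
  case False
  define y where "y = - x"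
  have y: "0 < y" "y \<le> 1" using False assms by (auto simp: y_def)
  have "1 + y + y\<^sup>2 / 2 \<le> exp y" using exp_lower_Taylor_quadratic[of y] y by simp
  \<comment> \<open>With \<open>x = - y\<close>, the claim is 1 \<le> (1 - y + y^2) exp y. The
    quadratic Taylor minorant of exp y already suffices, because the linear term of the product
    cancels and the rest has nonnegative coefficients.\<close>
  moreover have "1 \<le> (1 - y + y\<^sup>2) * (1 + y + y\<^sup>2 / 2)"
  proof -
    have "(1 - y + y\<^sup>2) * (1 + y + y\<^sup>2 / 2) = 1 + y\<^sup>2 / 2 + y^3 / 2 + y^4 / 2"
      by (simp add: field_simps power2_eq_square power3_eq_cube power4_eq_xxxx)
    then show ?thesis using y by simp
  qed
  moreover have "0 \<le> 1 - y + y\<^sup>2" using y by simp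
  ultimately have "1 \<le> (1 - y + y\<^sup>2) * exp y" by (meson mult_left_mono order_trans)
  then have "exp x \<le> 1 + x + x\<^sup>2" by (simp add: y_def exp_minus field_simps)
  then show ?thesis using exp_ge_add_one_self[of x] zero_le_power2[of x] by linarith
qed

section \<open>Integrability and differentiation of exponentials of bounded functions\<close>

lemma exp_mult_le_of_abs_le:
  fixes a :: real
  assumes "\<bar>a\<bar> \<le> B"
  shows "exp (\<theta> * a) \<le> exp (\<bar>\<theta>\<bar> * B)"
proof -
  have "\<theta> * a \<le> \<bar>\<theta>\<bar> * \<bar>a\<bar>" by (simp flip: abs_mult)
  also have "\<dots> \<le> \<bar>\<theta>\<bar> * B" using assms by (intro mult_left_mono) auto
  finally show ?thesis by simp
qed

lemma (in prob_space) integrable_of_abs_le: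
  fixes g :: "'a \<Rightarrow> real"
  assumes "g \<in> borel_measurable M" "\<And>x. x \<in> space M \<Longrightarrow> \<bar>g x\<bar> \<le> B"
  shows "integrable M g"
  using assms by (intro integrable_const_bound[where B=B]) auto

lemma (in prob_space) integrable_exp_of_abs_le:
  fixes g :: "'a \<Rightarrow> real"
  assumes "g \<in> borel_measurable M" "\<And>x. x \<in> space M \<Longrightarrow> \<bar>g x\<bar> \<le> B"
  shows "integrable M (\<lambda>x. exp (\<theta> * g x))"
proof (rule integrable_of_abs_le[where B="exp (\<bar>\<theta>\<bar> * B)"])
  show "\<bar>exp (\<theta> * g x)\<bar> \<le> exp (\<bar>\<theta>\<bar> * B)" if "x \<in> space M" for x
    using exp_mult_le_of_abs_le[OF assms(2)[OF that]] by simp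
qed (use assms in measurable)

lemma (in prob_space) integrable_mult_exp_of_abs_le:
  fixes g V :: "'a \<Rightarrow> real"
  assumes "integrable M V" "g \<in> borel_measurable M" "\<And>x. x \<in> space M \<Longrightarrow> \<bar>g x\<bar> \<le> B"
  shows "integrable M (\<lambda>x. V x * exp (\<theta> * g x))"
proof (rule Bochner_Integration.integrable_bound)
  show "integrable M (\<lambda>x. exp (\<bar>\<theta>\<bar> * B) * V x)" using assms by simp
  have "norm (V x * exp (\<theta> * g x)) \<le> norm (exp (\<bar>\<theta>\<bar> * B) * V x)" if "x \<in> space M" for x
    using mult_right_mono[OF exp_mult_le_of_abs_le[OF assms(3)[OF that]] abs_ge_zero[of "V x"]]
    by (simp add: abs_mult mult.commute)
  then show "AE x in M. norm (V x * exp (\<theta> * g x)) \<le> norm (exp (\<bar>\<theta>\<bar> * B) * V x)" by auto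
qed (use assms in measurable)

text \<open>The second-order bound on exp controls the error of the difference quotient by |h| C,
  uniformly in x, so it vanishes with h. Boundedness of \<open>g\<close> supplies the constant
  \<open>C\<close>.\<close>

lemma (in prob_space) mgf_has_derivative:
  fixes g :: "'a \<Rightarrow> real"
  assumes g[measurable]: "g \<in> borel_measurable M" and B: "\<And>x. x \<in> space M \<Longrightarrow> \<bar>g x\<bar> \<le> B"
  shows "((\<lambda>\<theta>. \<integral>x. exp (\<theta> * g x) \<partial>M) has_real_derivative (\<integral>x. g x * exp (\<theta> * g x) \<partial>M)) (at \<theta>)"
proof -
  define m where "m = (\<lambda>\<theta>. \<integral>x. exp (\<theta> * g x) \<partial>M)"
  define D where "D = (\<integral>x. g x * exp (\<theta> * g x) \<partial>M)"
  define C where "C = exp (\<bar>\<theta>\<bar> * B) * B\<^sup>2"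
  obtain x0 where "x0 \<in> space M" using not_empty by auto
  with B[of x0] have B0: "0 \<le> B" by linarith
  note int = integrable_exp_of_abs_le[OF g B]
  have intD: "integrable M (\<lambda>x. g x * exp (\<theta> * g x))"
    by (intro integrable_mult_exp_of_abs_le[OF integrable_of_abs_le[OF g B] g B])
  have bound: "\<bar>(m (\<theta> + h) - m \<theta>) / h - D\<bar> \<le> \<bar>h\<bar> * C" if h: "h \<noteq> 0" "\<bar>h\<bar> * B \<le> 1" for h
  proof -
    have "m (\<theta> + h) - m \<theta> - h * D
        = (\<integral>x. exp ((\<theta> + h) * g x) - exp (\<theta> * g x) - h * (g x * exp (\<theta> * g x)) \<partial>M)"
      using int intD by (simp add: m_def D_def)
    also have "\<bar>\<dots>\<bar> \<le> (\<integral>x. h\<^sup>2 * C \<partial>M)"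
    proof (rule integral_abs_bound[THEN order_trans], rule integral_mono)
      show "integrable M (\<lambda>x. \<bar>exp ((\<theta> + h) * g x) - exp (\<theta> * g x) - h * (g x * exp (\<theta> * g x))\<bar>)"
        using int intD by auto
      fix x assume x: "x \<in> space M"
      have e: "exp ((\<theta> + h) * g x) - exp (\<theta> * g x) - h * (g x * exp (\<theta> * g x))
          = exp (\<theta> * g x) * (exp (h * g x) - 1 - h * g x)"
        by (simp add: algebra_simps exp_add)
      have l1: "\<bar>h * g x\<bar> \<le> \<bar>h\<bar> * B"
        using B[OF x] by (simp add: abs_mult mult_left_mono)
      have "\<bar>exp (h * g x) - 1 - h * g x\<bar> \<le> (h * g x)\<^sup>2"
        using l1 h by (intro abs_exp_taylor_le) simp
      also have "\<dots> \<le> (\<bar>h\<bar> * B)\<^sup>2"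
        using l1 by (metis abs_ge_zero power2_abs power_mono)
      finally have l2: "\<bar>exp (h * g x) - 1 - h * g x\<bar> \<le> h\<^sup>2 * B\<^sup>2" by (simp add: power_mult_distrib)
      have "\<bar>exp (\<theta> * g x) * (exp (h * g x) - 1 - h * g x)\<bar> \<le> exp (\<bar>\<theta>\<bar> * B) * (h\<^sup>2 * B\<^sup>2)"
        using mult_mono[OF exp_mult_le_of_abs_le[OF B[OF x]] l2, of \<theta>] by (simp add: abs_mult)
      then show "\<bar>exp ((\<theta> + h) * g x) - exp (\<theta> * g x) - h * (g x * exp (\<theta> * g x))\<bar> \<le> h\<^sup>2 * C"
        unfolding e C_def by (simp add: mult.left_commute)
    qed simp
    also have "\<dots> = h\<^sup>2 * C" by (simp add: prob_space)
    finally have "\<bar>m (\<theta> + h) - m \<theta> - h * D\<bar> \<le> h\<^sup>2 * C" .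
    moreover have "(m (\<theta> + h) - m \<theta>) / h - D = (m (\<theta> + h) - m \<theta> - h * D) / h"
      using h by (simp add: field_simps)
    moreover have "h\<^sup>2 * C = \<bar>h\<bar> * C * \<bar>h\<bar>" by (simp add: power2_eq_square flip: abs_mult)
    ultimately show ?thesis using h by (simp add: abs_divide pos_divide_le_eq)
  qed
  have "((\<lambda>h. (m (\<theta> + h) - m \<theta>) / h - D) \<longlongrightarrow> 0) (at 0)"
  proof (rule Lim_null_comparison)
    have "\<forall>\<^sub>F h in at 0. \<bar>h\<bar> < 1 / (B + 1)"
      using B0 eventually_at_ball[of "1 / (B + 1)" "0::real" UNIV] by (simp add: dist_real_def)
    then show "\<forall>\<^sub>F h in at 0. norm ((m (\<theta> + h) - m \<theta>) / h - D) \<le> \<bar>h\<bar> * C"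
      using eventually_neq_at_within[of 0]
    proof eventually_elim
      case (elim h)
      \<comment> \<open>The radius 1 / (B + 1), rather than 1 / B, also covers B = 0.\<close>
      then have "\<bar>h\<bar> * B \<le> \<bar>h\<bar> * (B + 1)" by (intro mult_left_mono) auto
      also have "\<dots> \<le> 1" using elim B0 by (simp add: field_simps)
      finally show ?case using bound[of h] elim by simp
    qed
    show "((\<lambda>h. \<bar>h\<bar> * C) \<longlongrightarrow> 0) (at 0)"
      by (auto intro!: tendsto_eq_intros)
  qed
  then show ?thesis
    unfolding DERIV_def m_def[symmetric] D_def[symmetric] by (rule LIM_zero_cancel)
qed

section \<open>Differential inequality and Gibbs variational inequality\<close>

text \<open>Gronwall's argument: \<open>m \<theta> * exp (- (v * \<theta>\<^sup>2))\<close> has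
  nonpositive derivative on [0, T]. The inequality is asked on [0, T] only, since for nonconstant V
  it is established only for small \<theta>.\<close>

lemma gaussian_growth:
  fixes m :: "real \<Rightarrow> real"
  assumes T: "0 \<le> T" and der: "\<And>\<theta>. (m has_real_derivative m' \<theta>) (at \<theta>)"
    and le: "\<And>\<theta>. 0 \<le> \<theta> \<Longrightarrow> \<theta> \<le> T \<Longrightarrow> m' \<theta> \<le> 2 * v * \<theta> * m \<theta>"
    and "m 0 = 1"
  shows "m T \<le> exp (v * T\<^sup>2)"
proof -
  have "m T * exp (- (v * T\<^sup>2)) \<le> m 0 * exp (- (v * 0\<^sup>2))"
  proof (rule DERIV_nonpos_imp_nonincreasing[OF T])
    fix \<theta> assume \<theta>: "0 \<le> \<theta>" "\<theta> \<le> T"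
    have "((\<lambda>\<theta>. m \<theta> * exp (- (v * \<theta>\<^sup>2))) has_real_derivative
        (m' \<theta> - 2 * v * \<theta> * m \<theta>) * exp (- (v * \<theta>\<^sup>2))) (at \<theta>)"
      by (auto intro!: derivative_eq_intros der simp: algebra_simps)
    moreover have "(m' \<theta> - 2 * v * \<theta> * m \<theta>) * exp (- (v * \<theta>\<^sup>2)) \<le> 0"
      using le[OF \<theta>] by (simp add: mult_nonpos_nonneg)
    ultimately show "\<exists>y. ((\<lambda>\<theta>. m \<theta> * exp (- (v * \<theta>\<^sup>2))) has_real_derivative y) (at \<theta>) \<and> y \<le> 0"
      by blast
  qed
  then show ?thesis using \<open>m 0 = 1\<close> by (simp add: exp_minus field_simps)
qed

text \<open>The Fenchel-Young inequality for exp and its convex conjugate w ln w - w, which is 1 + s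
  \<le> exp s at s = u - ln w.\<close>

lemma gibbs_pointwise:
  fixes w u :: real
  assumes "0 < w"
  shows "w * u \<le> w * ln w - w + exp u"
proof -
  have "1 + (u - ln w) \<le> exp (u - ln w)" by simp
  also have "\<dots> = exp u / w" using assms by (simp add: exp_diff)
  finally show ?thesis using assms by (simp add: field_simps)
qed

text \<open>Gibbs' variational inequality for the probability density exp (\<theta> g) / m:
  integrate \<open>gibbs_pointwise\<close> with w this density and u = r V - z. The term -w
  contributes -1, and \<open>Z\<close> bounds the integral of exp u by 1, so the two cancel. The
  result is then multiplied by m.\<close>

lemma (in prob_space) exponential_tilt_le:
  fixes g V :: "'a \<Rightarrow> real" and \<theta> :: real
  assumes g[measurable]: "g \<in> borel_measurable M" and B: "\<And>x. x \<in> space M \<Longrightarrow> \<bar>g x\<bar> \<le> B"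
    and V: "integrable M V" and eV: "integrable M (\<lambda>x. exp (r * V x))"
    and Z: "(\<integral>x. exp (r * V x) \<partial>M) \<le> exp z"
  defines "m \<equiv> \<integral>x. exp (\<theta> * g x) \<partial>M"
  shows "r * (\<integral>x. V x * exp (\<theta> * g x) \<partial>M)
    \<le> z * m + \<theta> * (\<integral>x. g x * exp (\<theta> * g x) \<partial>M) - m * ln m"
proof -
  note ie = integrable_exp_of_abs_le[OF g B]
  note ig = integrable_mult_exp_of_abs_le[OF integrable_of_abs_le[OF g B] g B]
  note iV = integrable_mult_exp_of_abs_le[OF V g B]
  have "m > 0"
    using integral_less_AE_space[of "\<lambda>_. 0" "\<lambda>x. exp (\<theta> * g x)"] ie[of \<theta>]
    by (simp add: m_def emeasure_space_1)
  have "r * (\<integral>x. V x * exp (\<theta> * g x) \<partial>M) / m - z = (\<integral>x. exp (\<theta> * g x) / m * (r * V x - z) \<partial>M)"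
  proof -
    have "(\<integral>x. exp (\<theta> * g x) / m * (r * V x - z) \<partial>M)
      = (\<integral>x. (r / m) * (V x * exp (\<theta> * g x)) - (z / m) * exp (\<theta> * g x) \<partial>M)"
      by (intro Bochner_Integration.integral_cong) (simp_all add: right_diff_distrib diff_divide_distrib mult_ac)
    also have "\<dots> = (r / m) * (\<integral>x. V x * exp (\<theta> * g x) \<partial>M) - (z / m) * m"
      using ie[of \<theta>] iV[of \<theta>] by (simp add: m_def)
    finally show ?thesis using \<open>m > 0\<close> by (simp add: field_simps)
  qed
  also have "\<dots> \<le> (\<integral>x. (\<theta> / m) * (g x * exp (\<theta> * g x)) - (ln m / m + 1 / m) * exp (\<theta> * g x)
      + exp (- z) * exp (r * V x) \<partial>M)"
  proof (rule integral_mono)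
    have "(\<lambda>x. exp (\<theta> * g x) / m * (r * V x - z))
        = (\<lambda>x. (r / m) * (V x * exp (\<theta> * g x)) - (z / m) * exp (\<theta> * g x))"
      by (simp add: right_diff_distrib diff_divide_distrib mult_ac)
    then show "integrable M (\<lambda>x. exp (\<theta> * g x) / m * (r * V x - z))"
      using ie[of \<theta>] iV[of \<theta>] by simp
    fix x
    have "exp (\<theta> * g x) / m * (r * V x - z)
        \<le> exp (\<theta> * g x) / m * (\<theta> * g x - ln m) - exp (\<theta> * g x) / m + exp (r * V x - z)"
      using gibbs_pointwise[of "exp (\<theta> * g x) / m" "r * V x - z"] \<open>m > 0\<close> by (simp add: ln_div)
    also have "exp (r * V x - z) = exp (- z) * exp (r * V x)"
      by (simp flip: exp_add)
    finally show "exp (\<theta> * g x) / m * (r * V x - z) \<le> (\<theta> / m) * (g x * exp (\<theta> * g x))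
        - (ln m / m + 1 / m) * exp (\<theta> * g x) + exp (- z) * exp (r * V x)"
      by (simp add: right_diff_distrib distrib_right distrib_left diff_divide_distrib mult_ac)
  qed (use ie ig eV in auto)
  also have "\<dots> = (\<theta> / m) * (\<integral>x. g x * exp (\<theta> * g x) \<partial>M) - (ln m / m + 1 / m) * m
      + exp (- z) * (\<integral>x. exp (r * V x) \<partial>M)"
    using ie[of \<theta>] ig[of \<theta>] eV by (simp add: m_def)
  also have "\<dots> \<le> (\<theta> / m) * (\<integral>x. g x * exp (\<theta> * g x) \<partial>M) - ln m"
  proof -
    have "exp (- z) * (\<integral>x. exp (r * V x) \<partial>M) \<le> exp (- z) * exp z"
      using Z by (intro mult_left_mono) auto
    also have "\<dots> = 1" by (simp flip: exp_add)
    finally show ?thesis using \<open>m > 0\<close> by (simp add: distrib_right)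
  qed
  finally have "(r * (\<integral>x. V x * exp (\<theta> * g x) \<partial>M) / m - z) * m
      \<le> ((\<theta> / m) * (\<integral>x. g x * exp (\<theta> * g x) \<partial>M) - ln m) * m"
    using \<open>m > 0\<close> by (intro mult_right_mono) auto
  then show ?thesis
    unfolding left_diff_distrib using \<open>m > 0\<close> by (simp add: mult.commute)
qed

lemma (in prob_space) one_le_mgf:
  fixes g :: "'a \<Rightarrow> real"
  assumes g: "g \<in> borel_measurable M" and B: "\<And>x. x \<in> space M \<Longrightarrow> \<bar>g x\<bar> \<le> B"
    and mean: "(\<integral>x. g x \<partial>M) = 0"
  shows "1 \<le> (\<integral>x. exp (\<theta> * g x) \<partial>M)"
proof -
  note i = integrable_of_abs_le[OF g B]
  have "(\<integral>x. 1 + \<theta> * g x \<partial>M) \<le> (\<integral>x. exp (\<theta> * g x) \<partial>M)"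
    using i integrable_exp_of_abs_le[OF g B] by (intro integral_mono) auto
  then show ?thesis using i mean by (simp add: prob_space)
qed

section \<open>Tails from moment generating functions\<close>

text \<open>Chernoff's bound under a moment bound valid only for 2 c \<theta> \<le> 1. One statement
  serves both parts: c = 0 gives the Gaussian tail, and c equal to the inverse square root of L
  gives the second bound.\<close>

lemma (in prob_space) subgamma_tail:
  fixes g :: "'a \<Rightarrow> real"
  assumes g[measurable]: "g \<in> borel_measurable M" and "0 \<le> v" "0 \<le> c" "0 \<le> t"
    and mgf: "\<And>\<theta>. 0 \<le> \<theta> \<Longrightarrow> 2 * c * \<theta> \<le> 1 \<Longrightarrow> (\<integral>\<^sup>+x. ennreal (exp (\<theta> * g x)) \<partial>M) \<le> ennreal (exp (v * \<theta>\<^sup>2))"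
  shows "\<P>(x in M. t \<le> g x) \<le> exp (- (t\<^sup>2 / (4 * v + 4 * c * t)))"
proof (cases "0 < t \<and> 0 < v + c * t")
  case False
  \<comment> \<open>In the degenerate case the fraction is 0, possibly as a division by zero, and
    the claimed bound is 1.\<close>
  then have "t = 0 \<or> 4 * v + 4 * c * t = 0"
    using assms(2,4) mult_nonneg_nonneg[OF assms(3,4)] by linarith
  then have "t\<^sup>2 / (4 * v + 4 * c * t) = 0" by auto
  then show ?thesis by (metis exp_zero minus_zero prob_le_1)
next
  case True
  \<comment> \<open>This choice is admissible and has v \<theta> \<le> t / 2. The exponent v
    \<theta>^2 - \<theta> t is then at most - \<theta> t / 2, which is the claimed one.\<close>
  define \<theta> where "\<theta> = t / (2 * v + 2 * c * t)"
  have den: "0 < 2 * v + 2 * c * t" using True by linarith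
  have \<theta>: "0 < \<theta>" "2 * c * \<theta> \<le> 1"
    using True den assms(2-4) by (auto simp: \<theta>_def field_simps)
  have "v * \<theta> \<le> t / 2"
    using True den assms(2-4) by (auto simp: \<theta>_def field_simps)
  then have *: "v * \<theta> * \<theta> \<le> t / 2 * \<theta>" using \<theta> by (intro mult_right_mono) auto
  have **: "t / 2 * \<theta> = t\<^sup>2 / (4 * v + 4 * c * t)"
    using den by (simp add: \<theta>_def power2_eq_square field_simps)
  have e: "- \<theta> * t + v * \<theta>\<^sup>2 \<le> - (t\<^sup>2 / (4 * v + 4 * c * t))"
  proof -
    have "- \<theta> * t + v * \<theta>\<^sup>2 = v * \<theta> * \<theta> - 2 * (t / 2 * \<theta>)"
      by (simp add: power2_eq_square)
    with * ** show ?thesis by linarith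
  qed
  have "emeasure M {x \<in> space M. t \<le> g x}
      \<le> ennreal (exp (- \<theta> * t)) * (\<integral>\<^sup>+x. ennreal (exp (\<theta> * g x)) * indicator (space M) x \<partial>M)"
    by (intro Chernoff_ineq_nn_integral_ge \<theta>) auto
  also have "(\<integral>\<^sup>+x. ennreal (exp (\<theta> * g x)) * indicator (space M) x \<partial>M) = (\<integral>\<^sup>+x. ennreal (exp (\<theta> * g x)) \<partial>M)"
    by (intro nn_integral_cong) auto
  also have "ennreal (exp (- \<theta> * t)) * \<dots> \<le> ennreal (exp (- \<theta> * t)) * ennreal (exp (v * \<theta>\<^sup>2))"
    using mgf[of \<theta>] \<theta> by (intro mult_left_mono) auto
  also have "\<dots> = ennreal (exp (- \<theta> * t + v * \<theta>\<^sup>2))"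
    by (simp add: exp_diff exp_minus divide_inverse mult.commute flip: ennreal_mult)
  also have "\<dots> \<le> ennreal (exp (- (t\<^sup>2 / (4 * v + 4 * c * t))))"
    using e by (intro ennreal_leI) simp
  finally show ?thesis by (simp add: emeasure_eq_measure)
qed

lemma (in prob_space) two_sided_tail:
  fixes g :: "'a \<Rightarrow> real"
  assumes [measurable]: "g \<in> borel_measurable M"
    and "\<P>(x in M. t \<le> g x) \<le> p" "\<P>(x in M. t \<le> - g x) \<le> p"
  shows "\<P>(x in M. \<bar>g x\<bar> \<ge> t) \<le> 2 * p"
proof -
  have "\<P>(x in M. \<bar>g x\<bar> \<ge> t) \<le> measure M ({x \<in> space M. t \<le> g x} \<union> {x \<in> space M. t \<le> - g x})"
    by (intro finite_measure_mono) auto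
  also have "\<dots> \<le> \<P>(x in M. t \<le> g x) + \<P>(x in M. t \<le> - g x)"
    by (intro measure_Un_le) auto
  finally show ?thesis using assms by linarith
qed

section \<open>Limits of truncations and increments of exp\<close>

text \<open>Fatou's lemma in the form that removes truncations: a bound uniform in n passes to the
  pointwise limit.\<close>

lemma nn_integral_fatou_le:
  fixes g :: "'a \<Rightarrow> real"
  assumes [measurable]: "\<And>n. G n \<in> borel_measurable M"
    and lim: "\<And>x. x \<in> space M \<Longrightarrow> (\<lambda>n. G n x) \<longlonglongrightarrow> g x"
    and le: "\<And>n. (\<integral>\<^sup>+x. ennreal (G n x) \<partial>M) \<le> C"
  shows "(\<integral>\<^sup>+x. ennreal (g x) \<partial>M) \<le> C"
proof -
  have "(\<integral>\<^sup>+x. ennreal (g x) \<partial>M) = (\<integral>\<^sup>+x. liminf (\<lambda>n. ennreal (G n x)) \<partial>M)"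
    using lim by (intro nn_integral_cong lim_imp_Liminf[symmetric] tendsto_ennrealI) auto
  also have "\<dots> \<le> liminf (\<lambda>n. \<integral>\<^sup>+x. ennreal (G n x) \<partial>M)"
    by (intro nn_integral_liminf) measurable
  also have "\<dots> \<le> limsup (\<lambda>n. \<integral>\<^sup>+x. ennreal (G n x) \<partial>M)"
    by (intro Liminf_le_Limsup) simp
  also have "\<dots> \<le> C" using le by (intro Limsup_bounded) auto
  finally show ?thesis .
qed

text \<open>The trapezoid rule overestimates the integral of the convex function exp between b and
  a. Compared with the mean value bound by the maximum, the average of both endpoints is symmetric
  in a and b and keeps a factor 1/2 that the final constants rely on.\<close>

lemma abs_exp_diff_le:
  fixes a b :: real
  shows "\<bar>exp a - exp b\<bar> \<le> \<bar>a - b\<bar> * (exp a + exp b) / 2"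
proof -
  have base: "exp x - 1 \<le> x * (exp x + 1) / 2" if "0 \<le> x" for x :: real
  proof -
    have "0 * (exp 0 + 1) / 2 - (exp 0 - 1) \<le> x * (exp x + 1) / 2 - (exp x - 1)"
    proof (rule DERIV_nonneg_imp_nondecreasing[OF that])
      fix y :: real
      have "((\<lambda>x. x * (exp x + 1) / 2 - (exp x - 1)) has_real_derivative (1 - exp y + y * exp y) / 2) (at y)"
        by (auto intro!: derivative_eq_intros simp: field_simps)
      moreover have "(1 - exp y + y * exp y) / 2 \<ge> 0"
      proof -
        have "(1 - y) * exp y \<le> exp (- y) * exp y"
          using exp_ge_add_one_self[of "- y"] by (intro mult_right_mono) auto
        also have "\<dots> = 1" by (simp flip: exp_add)
        finally show ?thesis by (simp add: algebra_simps)
      qed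
      ultimately show "\<exists>z. ((\<lambda>x. x * (exp x + 1) / 2 - (exp x - 1)) has_real_derivative z) (at y) \<and> 0 \<le> z"
        by blast
    qed
    then show ?thesis by simp
  qed
  have *: "exp a - exp b \<le> (a - b) * (exp a + exp b) / 2" if "b \<le> a" for a b :: real
  proof -
    have "(exp (a - b) - 1) * exp b \<le> (a - b) * (exp (a - b) + 1) / 2 * exp b"
      using base[of "a - b"] that by (intro mult_right_mono) auto
    moreover have "exp (a - b) * exp b = exp a" by (simp flip: exp_add)
    moreover have "(a - b) * (exp (a - b) + 1) / 2 * exp b = (a - b) * (exp (a - b) * exp b + exp b) / 2"
      by (simp add: distrib_right distrib_left)
    ultimately show ?thesis by (simp add: left_diff_distrib)
  qed
  show ?thesis
    using *[of a b] *[of b a] by (cases "b \<le> a") (simp_all add: add.commute)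
qed

section \<open>Reversible kernels with summable curvature\<close>

text \<open>The easy half of Kantorovich-Rubinstein duality: any coupling turns the difference into
  the integral of g X - g Y, which is at most the integral of the distance.\<close>

lemma abs_diff_integral_le_W1:
  fixes g :: "'a::polish_space \<Rightarrow> real"
  assumes lip: "1-lipschitz_on UNIV g" and bd: "\<And>x. \<bar>g x\<bar> \<le> B"
    and \<mu>: "prob_space \<mu>"
  shows "ennreal \<bar>(\<integral>x. g x \<partial>\<mu>) - (\<integral>x. g x \<partial>\<nu>)\<bar> \<le> W1 \<mu> \<nu>"
  unfolding W1_def
proof (rule INF_greatest)
  have [measurable]: "g \<in> borel_measurable borel"
    using lip by (intro borel_measurable_continuous_onI lipschitz_on_continuous_on)
  fix \<gamma> assume \<gamma>: "\<gamma> \<in> couplings \<mu> \<nu>"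
  then have [measurable_cong]: "sets \<gamma> = sets (borel \<Otimes>\<^sub>M borel)"
    and \<mu>_eq: "\<mu> = distr \<gamma> borel fst" and \<nu>_eq: "\<nu> = distr \<gamma> borel snd"
    by (auto simp: couplings_def)
  \<comment> \<open>A coupling inherits total mass one from its first marginal.\<close>
  interpret prob_space \<gamma>
    using \<mu> unfolding \<mu>_eq by (rule prob_space_distrD[rotated]) measurable
  have "(\<integral>x. g x \<partial>\<mu>) - (\<integral>x. g x \<partial>\<nu>) = (\<integral>p. g (fst p) - g (snd p) \<partial>\<gamma>)"
    unfolding \<mu>_eq \<nu>_eq using bd
    by (simp add: integral_distr integrable_of_abs_le[where B=B] Bochner_Integration.integral_diff)
  also have "ennreal \<bar>\<dots>\<bar> \<le> (\<integral>\<^sup>+p. ennreal \<bar>g (fst p) - g (snd p)\<bar> \<partial>\<gamma>)"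
    using integral_norm_bound_ennreal[of \<gamma> "\<lambda>p. g (fst p) - g (snd p)"] bd
    by (simp add: integrable_of_abs_le[where B=B])
  also have "\<dots> \<le> (\<integral>\<^sup>+p. ennreal (dist (fst p) (snd p)) \<partial>\<gamma>)"
    using lipschitz_onD[OF lip] by (intro nn_integral_mono ennreal_leI) (simp add: dist_real_def)
  finally show "ennreal \<bar>(\<integral>x. g x \<partial>\<mu>) - (\<integral>x. g x \<partial>\<nu>)\<bar> \<le> (\<integral>\<^sup>+p. ennreal (dist (fst p) (snd p)) \<partial>\<gamma>)" .
qed

text \<open>Solves the definition of the curvature for \<open>W1\<close>. An infinite
  \<open>W1\<close> gives curvature minus infinity, and multiplying back by the positive distance
  restores infinity.\<close>

lemma W1_eq_curv_at:
  assumes "x \<noteq> y"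
  shows "W1 (kernel_pow P k x) (kernel_pow P k y) = e2ennreal (1 - curv_at P k x y) * ennreal (dist x y)"
proof (cases "W1 (kernel_pow P k x) (kernel_pow P k y)" rule: ennreal_cases)
  case top
  have "1 - curv_at P k x y = \<infinity>"
    using assms top by (simp add: curv_at_def one_ereal_def)
  then show ?thesis using assms top by (simp add: ennreal_top_mult)
next
  case (real w)
  have "1 - curv_at P k x y = ereal (w / dist x y)"
    using assms real by (simp add: curv_at_def one_ereal_def)
  then show ?thesis using assms real by (simp flip: ennreal_mult ennreal.rep_eq add: e2ennreal_ereal)
qed

section \<open>The Markov kernel and its powers as operators\<close>

text \<open>The two finiteness conditions single out the case in which the bounds are not trivial by
  convention.\<close>

locale reversible_kernel =
  fixes P :: "'a::polish_space \<Rightarrow> 'a measure" and \<pi> :: "'a measure"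
  assumes kernel: "P \<in> borel \<rightarrow>\<^sub>M prob_algebra borel"
    and stationary: "stationary P \<pi>"
    and reversible: "reversible P \<pi>"
    and curv_sum_finite: "curv_sum P < \<infinity>"
    and jump_max_finite: "jump_max P < \<infinity>"
begin

text \<open>The Markov operator P^k applied to g, evaluated at x.\<close>

definition avg :: "nat \<Rightarrow> ('a \<Rightarrow> real) \<Rightarrow> 'a \<Rightarrow> real" where
  "avg k g x = (\<integral>y. g y \<partial>kernel_pow P k x)"

lemma kernel_pow_measurable[measurable]: "kernel_pow P k \<in> borel \<rightarrow>\<^sub>M prob_algebra borel"
proof (induction k)
  case (Suc k)
  then show ?case by (simp add: measurable_bind_prob_space[OF _ kernel])
qed simp

lemmas kernel_pow_subprob[measurable] = measurable_prob_algebraD[OF kernel_pow_measurable]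

lemma kernel_measurable[measurable]: "P \<in> borel \<rightarrow>\<^sub>M prob_algebra borel"
  by (rule kernel)

lemmas kernel_subprob[measurable] = measurable_prob_algebraD[OF kernel]

lemma prob_space_of_kernel:
  assumes "K \<in> borel \<rightarrow>\<^sub>M prob_algebra N"
  shows "prob_space (K (x :: 'a))" "sets (K x) = sets N"
  using measurable_space[OF assms, of x] by (auto simp: space_prob_algebra)

lemmas prob_space_kernel_pow = prob_space_of_kernel(1)[OF kernel_pow_measurable]
lemmas prob_space_kernel = prob_space_of_kernel(1)[OF kernel]
lemmas sets_kernel_pow[simp, measurable_cong] = prob_space_of_kernel(2)[OF kernel_pow_measurable]
lemmas sets_kernel[simp, measurable_cong] = prob_space_of_kernel(2)[OF kernel]

lemma space_kernel[simp]: "space (P x) = UNIV" "space (kernel_pow P k x) = UNIV"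
  using sets_eq_imp_space_eq[OF sets_kernel] sets_eq_imp_space_eq[OF sets_kernel_pow] by auto

lemma sets_pi[simp, measurable_cong]: "sets \<pi> = sets borel"
  and prob_space_pi: "prob_space \<pi>"
  and bind_pi: "\<pi> \<bind> P = \<pi>"
  using stationary by (auto simp: stationary_def space_prob_algebra)

lemma space_pi[simp]: "space \<pi> = UNIV"
  using sets_eq_imp_space_eq[OF sets_pi] by simp

sublocale prob_space \<pi> by (rule prob_space_pi)

lemma prob_UNIV[simp]: "prob UNIV = 1"
  using prob_space by simp

lemma kernel_subprob_pi[measurable]: "P \<in> \<pi> \<rightarrow>\<^sub>M subprob_algebra borel"
  "kernel_pow P k \<in> \<pi> \<rightarrow>\<^sub>M subprob_algebra borel"
  using kernel_subprob kernel_pow_subprob by (simp_all add: measurable_cong_sets[OF sets_pi refl])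

lemma kernel_subprob_kernel: "P \<in> P x \<rightarrow>\<^sub>M subprob_algebra borel"
  "P \<in> kernel_pow P k x \<rightarrow>\<^sub>M subprob_algebra borel"
  "kernel_pow P k \<in> P x \<rightarrow>\<^sub>M subprob_algebra borel"
  using kernel_subprob kernel_pow_subprob
  by (simp_all add: measurable_cong_sets[OF sets_kernel refl] measurable_cong_sets[OF sets_kernel_pow refl])

text \<open>\<open>kernel_pow\<close> appends each new step at the end. Associativity of bind allows
  the first step to be split off instead, which is what P (P^k g) = P^(k+1) g needs.\<close>

lemma bind_kernel_pow: "P x \<bind> kernel_pow P k = kernel_pow P (Suc k) x"
proof (induction k arbitrary: x)
  case 0
  show ?case
    by (simp add: bind_return'' bind_return[OF kernel_subprob])
next
  case (Suc k)
  have "P x \<bind> kernel_pow P (Suc k) = (P x \<bind> kernel_pow P k) \<bind> P"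
    by (simp add: bind_assoc[OF kernel_subprob_kernel(3) kernel_subprob])
  then show ?case using Suc by simp
qed

lemma bind_pi_kernel_pow: "\<pi> \<bind> kernel_pow P k = \<pi>"
proof (induction k)
  case 0
  show ?case by (simp add: bind_return'')
next
  case (Suc k)
  have "\<pi> \<bind> kernel_pow P (Suc k) = (\<pi> \<bind> kernel_pow P k) \<bind> P"
    by (simp add: bind_assoc[OF kernel_subprob_pi(2) kernel_subprob])
  then show ?case using Suc bind_pi by simp
qed

lemma integral_bind_prob:
  fixes g :: "'b \<Rightarrow> real"
  assumes "prob_space M" "N \<in> M \<rightarrow>\<^sub>M prob_algebra K" "g \<in> borel_measurable K" "\<And>x. \<bar>g x\<bar> \<le> B"
  shows "(\<integral>x. g x \<partial>(M \<bind> N)) = (\<integral>x. \<integral>y. g y \<partial>N x \<partial>M)"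
proof (rule integral_bind[where B=B and B'=1])
  show "AE x in M. emeasure (N x) (space (N x)) \<le> ennreal 1"
    using measurable_space[OF assms(2)]
    by (auto intro!: AE_I2 simp: space_prob_algebra prob_space.emeasure_space_1)
qed (use assms in \<open>auto intro: measurable_prob_algebraD prob_space.axioms(1)
  simp: prob_space.finite_measure\<close>)

lemma avg_measurable[measurable]:
  "g \<in> borel_measurable borel \<Longrightarrow> avg k g \<in> borel_measurable borel"
  unfolding avg_def
  by (rule measurable_compose[OF kernel_pow_subprob integral_measurable_subprob_algebra])

lemma abs_avg_le:
  assumes "g \<in> borel_measurable borel" "\<And>x. \<bar>g x\<bar> \<le> B"
  shows "\<bar>avg k g x\<bar> \<le> B"
proof -
  interpret K: prob_space "kernel_pow P k x" by (rule prob_space_kernel_pow)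
  have "\<bar>avg k g x\<bar> \<le> (\<integral>y. B \<partial>kernel_pow P k x)"
    unfolding avg_def using assms
    by (intro integral_abs_bound[THEN order_trans] integral_mono) (auto intro!: K.integrable_of_abs_le[where B=B])
  then show ?thesis using K.prob_space by simp
qed

lemma avg_Suc:
  assumes g: "g \<in> borel_measurable borel" "\<And>x. \<bar>g x\<bar> \<le> B"
  shows "avg (Suc k) g x = (\<integral>y. avg k g y \<partial>P x)"
  unfolding avg_def bind_kernel_pow[symmetric]
  by (rule integral_bind_prob[OF prob_space_kernel _ g])
    (simp add: measurable_cong_sets[OF sets_kernel refl])

lemma integral_avg:
  assumes g: "g \<in> borel_measurable borel" "\<And>x. \<bar>g x\<bar> \<le> B"
  shows "(\<integral>x. avg k g x \<partial>\<pi>) = (\<integral>x. g x \<partial>\<pi>)"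
proof -
  have "(\<integral>x. g x \<partial>(\<pi> \<bind> kernel_pow P k)) = (\<integral>x. avg k g x \<partial>\<pi>)"
    unfolding avg_def by (rule integral_bind_prob[OF prob_space_pi _ g])
      (simp add: measurable_cong_sets[OF sets_pi refl])
  then show ?thesis by (simp add: bind_pi_kernel_pow)
qed

section \<open>Contraction of Lipschitz functions\<close>

text \<open>The real number 1 - \<kappa>_k, a Lipschitz constant of P^k g for every bounded
  1-Lipschitz g. No information is lost, since a term of the finite sum \<open>curv_sum P\<close> is
  finite.\<close>

definition slope :: "nat \<Rightarrow> real" where
  "slope k = enn2real (e2ennreal (1 - curv P k))"

lemma slope_nonneg: "0 \<le> slope k"
  by (simp add: slope_def)

lemma ennreal_slope: "ennreal (slope k) = e2ennreal (1 - curv P k)"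
proof -
  have "e2ennreal (1 - curv P k) \<le> curv_sum P"
    unfolding curv_sum_def using sum_le_suminf[of "\<lambda>k. e2ennreal (1 - curv P k)" "{k}"] by simp
  with curv_sum_finite show ?thesis by (simp add: slope_def)
qed

text \<open>Terms of a convergent series tend to 0. This gives both a power of P that halves
  Lipschitz constants and the convergence of P^k g to the mean of g.\<close>

lemma slope_tendsto: "slope \<longlonglongrightarrow> 0"
proof -
  have "(\<Sum>k. ennreal (slope k)) \<noteq> top"
    using curv_sum_finite by (simp add: ennreal_slope curv_sum_def)
  then show ?thesis
    by (intro summable_LIMSEQ_zero summable_suminf_not_top slope_nonneg)
qed

lemma slope_at_le: "e2ennreal (1 - curv_at P k x y) \<le> ennreal (slope k)"
  unfolding ennreal_slope curv_def
  by (intro e2ennreal_mono ereal_minus_mono order_refl INF_lower2[of x] INF_lower) auto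

lemma curv_sum_at_le: "curv_sum_at P x y \<le> curv_sum P"
  unfolding curv_sum_at_def curv_sum_def
  by (intro suminf_le summableI) (use slope_at_le in \<open>simp add: ennreal_slope\<close>)

lemma avg_diff_le_at:
  assumes "1-lipschitz_on UNIV g" "\<And>x. \<bar>g x\<bar> \<le> B"
  shows "ennreal \<bar>avg k g x - avg k g y\<bar> \<le> e2ennreal (1 - curv_at P k x y) * ennreal (dist x y)"
proof (cases "x = y")
  case False
  then show ?thesis
    using abs_diff_integral_le_W1[OF assms prob_space_kernel_pow] unfolding avg_def
    by (simp flip: W1_eq_curv_at)
qed simp

lemma avg_diff_le:
  assumes "1-lipschitz_on UNIV g" "\<And>x. \<bar>g x\<bar> \<le> B"
  shows "\<bar>avg k g x - avg k g y\<bar> \<le> slope k * dist x y"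
proof -
  have "ennreal \<bar>avg k g x - avg k g y\<bar> \<le> ennreal (slope k) * ennreal (dist x y)"
    using avg_diff_le_at[OF assms] slope_at_le by (rule order_trans[OF _ mult_right_mono]) auto
  then show ?thesis by (simp add: slope_nonneg flip: ennreal_mult)
qed

text \<open>Sums the contraction of each P^k at the pair (x, y). The bound is local, as the
  condition on V requires, and does not depend on n, so the limit in n can be taken later.\<close>

lemma sum_avg_diff_le:
  assumes "1-lipschitz_on UNIV g" "\<And>x. \<bar>g x\<bar> \<le> B"
  shows "ennreal \<bar>(\<Sum>k<n. avg k g x) - (\<Sum>k<n. avg k g y)\<bar> \<le> curv_sum_at P x y * ennreal (dist x y)"
proof -
  have "ennreal \<bar>(\<Sum>k<n. avg k g x) - (\<Sum>k<n. avg k g y)\<bar> \<le> ennreal (\<Sum>k<n. \<bar>avg k g x - avg k g y\<bar>)"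
    unfolding sum_subtractf[symmetric] by (intro ennreal_leI sum_abs)
  also have "\<dots> = (\<Sum>k<n. ennreal \<bar>avg k g x - avg k g y\<bar>)" by (simp add: sum_ennreal)
  also have "\<dots> \<le> (\<Sum>k<n. e2ennreal (1 - curv_at P k x y) * ennreal (dist x y))"
    by (intro sum_mono avg_diff_le_at[OF assms])
  also have "\<dots> = (\<Sum>k<n. e2ennreal (1 - curv_at P k x y)) * ennreal (dist x y)"
    by (simp add: sum_distrib_right)
  also have "\<dots> \<le> curv_sum_at P x y * ennreal (dist x y)"
    unfolding curv_sum_at_def by (intro mult_right_mono sum_le_suminf) auto
  finally show ?thesis .
qed

section \<open>Integrability of Lipschitz functions under the stationary law\<close>

definition sigma2 :: real where
  "sigma2 = (enn2real (jump_max P))\<^sup>2"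

lemma jump_square_le: "(\<integral>\<^sup>+y. ennreal ((dist x y)\<^sup>2) \<partial>P x) \<le> ennreal sigma2"
proof -
  define I where "I = (\<integral>\<^sup>+y. ennreal ((dist x y)\<^sup>2) \<partial>P x)"
  have *: "jump P x \<le> jump_max P" unfolding jump_max_def by (rule SUP_upper) simp
  then have fin: "I < \<infinity>"
    using jump_max_finite by (auto simp: jump_def Let_def I_def top.not_eq_extremum split: if_splits)
  then have "ennreal (sqrt (enn2real I)) \<le> ennreal (enn2real (jump_max P))"
    using * jump_max_finite by (auto simp: jump_def Let_def I_def split: if_splits)
  then have "sqrt (enn2real I) \<le> enn2real (jump_max P)" by simp
  then have "enn2real I \<le> sigma2" unfolding sigma2_def by (metis sqrt_le_D)
  then show ?thesis using fin unfolding I_def[symmetric]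
    by (metis ennreal_enn2real ennreal_leI infinity_ennreal_def)
qed

text \<open>By the triangle inequality each step adds its mean length, and d \<le> 1 + d^2 bounds
  that by \<open>1 + sigma2\<close>. The estimate is crude; it serves to have a finite bound that
  involves no truncation level.\<close>

lemma nn_integral_dist_kernel_pow_le:
  "(\<integral>\<^sup>+y. ennreal (dist x y) \<partial>kernel_pow P k x) \<le> ennreal (real k * (1 + sigma2))"
proof (induction k)
  case 0
  show ?case by (simp add: nn_integral_return)
next
  case (Suc k)
  interpret K: prob_space "kernel_pow P k x" by (rule prob_space_kernel_pow)
  have step: "(\<integral>\<^sup>+z. ennreal (dist y z) \<partial>P y) \<le> ennreal (1 + sigma2)" for y
  proof -
    interpret Q: prob_space "P y" by (rule prob_space_kernel)
    have "dist y z \<le> 1 + (dist y z)\<^sup>2" for z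
      using sum_squares_ge_zero[of "dist y z - 1" 0] zero_le_power2[of "dist y z"]
      by (simp add: power2_eq_square algebra_simps) (smt (verit) zero_le_dist)
    then have "(\<integral>\<^sup>+z. ennreal (dist y z) \<partial>P y) \<le> (\<integral>\<^sup>+z. 1 + ennreal ((dist y z)\<^sup>2) \<partial>P y)"
      by (intro nn_integral_mono) (metis ennreal_1 ennreal_leI ennreal_plus zero_le_one zero_le_power2)
    also have "\<dots> = 1 + (\<integral>\<^sup>+z. ennreal ((dist y z)\<^sup>2) \<partial>P y)"
      using Q.emeasure_space_1 by (simp add: nn_integral_add)
    also have "\<dots> \<le> 1 + ennreal sigma2" by (intro add_left_mono jump_square_le)
    finally show ?thesis by (simp add: sigma2_def)
  qed
  have "(\<integral>\<^sup>+y. ennreal (dist x y) \<partial>kernel_pow P (Suc k) x)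
      = (\<integral>\<^sup>+y. \<integral>\<^sup>+z. ennreal (dist x z) \<partial>P y \<partial>kernel_pow P k x)"
    by (simp add: nn_integral_bind[OF _ kernel_subprob_kernel(2)])
  also have "\<dots> \<le> (\<integral>\<^sup>+y. ennreal (dist x y) + ennreal (1 + sigma2) \<partial>kernel_pow P k x)"
  proof (intro nn_integral_mono)
    fix y
    interpret Q: prob_space "P y" by (rule prob_space_kernel)
    have "(\<integral>\<^sup>+z. ennreal (dist x z) \<partial>P y) \<le> (\<integral>\<^sup>+z. ennreal (dist x y) + ennreal (dist y z) \<partial>P y)"
      by (intro nn_integral_mono) (simp add: dist_triangle flip: ennreal_plus)
    also have "\<dots> = ennreal (dist x y) + (\<integral>\<^sup>+z. ennreal (dist y z) \<partial>P y)"
      using Q.emeasure_space_1 by (simp add: nn_integral_add)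
    also have "\<dots> \<le> ennreal (dist x y) + ennreal (1 + sigma2)" by (intro add_left_mono step)
    finally show "(\<integral>\<^sup>+z. ennreal (dist x z) \<partial>P y) \<le> ennreal (dist x y) + ennreal (1 + sigma2)" .
  qed
  also have "\<dots> = (\<integral>\<^sup>+y. ennreal (dist x y) \<partial>kernel_pow P k x) + ennreal (1 + sigma2)"
    using K.emeasure_space_1 by (simp add: nn_integral_add)
  also have "\<dots> \<le> ennreal (real k * (1 + sigma2)) + ennreal (1 + sigma2)"
    by (intro add_right_mono Suc)
  also have "\<dots> = ennreal (real (Suc k) * (1 + sigma2))"
    by (simp add: sigma2_def distrib_right flip: ennreal_plus)
  finally show ?case .
qed


lemma lipschitz_measurable:
  fixes h :: "'a \<Rightarrow> real"
  assumes "C-lipschitz_on UNIV h" shows "h \<in> borel_measurable borel"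
  using assms by (intro borel_measurable_continuous_onI lipschitz_on_continuous_on)

text \<open>Some \<open>P\<^sup>k\<close> is a \<open>1/2\<close>-contraction, so truncations \<open>g\<close> of \<open>dist x\<close> satisfy
  \<open>P\<^sup>k g \<le> C + dist x / 2\<close> with \<open>C\<close> independent of the truncation; stationarity makes \<open>g - P\<^sup>k g\<close>
  integrate to \<open>0\<close>.\<close>

lemma integrable_dist: "integrable \<pi> (dist x)"
proof -
  obtain k where k: "slope k < 1 / 2"
    using order_tendstoD(2)[OF slope_tendsto, of "1/2"] by (auto simp: eventually_sequentially)
  define C where "C = real k * (1 + sigma2)"
  have "0 \<le> C" by (simp add: C_def sigma2_def)
  have trunc: "(\<integral>\<^sup>+y. ennreal (if dist x y \<le> M then dist x y / 2 else 0) \<partial>\<pi>) \<le> ennreal C" if "0 \<le> M" for M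
  proof -
    define g where "g = (\<lambda>y. min (dist x y) M)"
    have lip: "1-lipschitz_on UNIV g"
      by (rule lipschitz_onI) (auto simp: g_def dist_real_def min_def abs_le_iff,
        (smt (verit) dist_triangle dist_commute)+)
    have bd: "\<bar>g y\<bar> \<le> M" for y using that by (auto simp: g_def)
    note [measurable] = lipschitz_measurable[OF lip]
    have "ennreal (avg k g x) \<le> (\<integral>\<^sup>+y. ennreal (dist x y) \<partial>kernel_pow P k x)"
    proof -
      interpret K: prob_space "kernel_pow P k x" by (rule prob_space_kernel_pow)
      have "ennreal (avg k g x) = (\<integral>\<^sup>+y. ennreal (g y) \<partial>kernel_pow P k x)"
        unfolding avg_def using bd that
        by (intro nn_integral_eq_integral[symmetric] K.integrable_of_abs_le[where B=M]) (auto simp: g_def)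
      also have "\<dots> \<le> (\<integral>\<^sup>+y. ennreal (dist x y) \<partial>kernel_pow P k x)"
        by (intro nn_integral_mono ennreal_leI) (simp add: g_def)
      finally show ?thesis .
    qed
    also have "\<dots> \<le> ennreal C" unfolding C_def by (rule nn_integral_dist_kernel_pow_le)
    finally have base: "avg k g x \<le> C" using \<open>0 \<le> C\<close> by simp
    have avg_le: "avg k g y \<le> C + dist x y / 2" for y
    proof -
      have "avg k g y - avg k g x \<le> slope k * dist y x"
        using avg_diff_le[OF lip bd, of k y x] by linarith
      also have "\<dots> \<le> 1 / 2 * dist y x" using k by (intro mult_right_mono) auto
      finally show ?thesis using base by (simp add: dist_commute)
    qed
    have avg_le_M: "avg k g y \<le> M" for y
      using abs_avg_le[of g M k y] bd by (simp add: abs_le_iff)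
    have int: "integrable \<pi> g" "integrable \<pi> (avg k g)"
      using bd abs_avg_le[of g M k] by (auto intro!: integrable_of_abs_le[where B=M])
    have "(\<integral>\<^sup>+y. ennreal (if dist x y \<le> M then dist x y / 2 else 0) \<partial>\<pi>)
        \<le> (\<integral>\<^sup>+y. ennreal (g y - avg k g y + C) \<partial>\<pi>)"
    proof (intro nn_integral_mono ennreal_leI)
      fix y
      \<comment> \<open>Where dist x y \<le> M, the bound \<open>avg_le\<close> leaves at least half
        the distance. Elsewhere g equals M, which dominates P^k g.\<close>
      show "(if dist x y \<le> M then dist x y / 2 else 0) \<le> g y - avg k g y + C"
        using avg_le[of y] avg_le_M[of y] \<open>0 \<le> C\<close> by (auto simp: g_def)
    qed
    also have "\<dots> = ennreal (\<integral>y. g y - avg k g y + C \<partial>\<pi>)"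
    proof (rule nn_integral_eq_integral)
      show "integrable \<pi> (\<lambda>y. g y - avg k g y + C)" using int by simp
      show "AE y in \<pi>. 0 \<le> g y - avg k g y + C"
        using avg_le avg_le_M \<open>0 \<le> C\<close>
        by (intro AE_I2) (smt (verit) g_def zero_le_dist field_sum_of_halves)
    qed
    also have "(\<integral>y. g y - avg k g y + C \<partial>\<pi>) = C"
      using int integral_avg[of g M k] bd by (simp add: prob_space)
    finally show ?thesis .
  qed
  have "(\<integral>\<^sup>+y. ennreal (dist x y / 2) \<partial>\<pi>) \<le> ennreal C"
  proof (rule nn_integral_fatou_le)
    fix n :: nat
    show "(\<integral>\<^sup>+y. ennreal (if dist x y \<le> real n then dist x y / 2 else 0) \<partial>\<pi>) \<le> ennreal C"
      by (rule trunc) simp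
  next
    fix y
    obtain N where "dist x y \<le> real N" using real_arch_simple by blast
    then have "\<forall>\<^sub>F n in sequentially. (if dist x y \<le> real n then dist x y / 2 else 0) = dist x y / 2"
      by (intro eventually_sequentiallyI[of N]) auto
    then show "(\<lambda>n. if dist x y \<le> real n then dist x y / 2 else 0) \<longlonglongrightarrow> dist x y / 2"
      by (rule tendsto_eventually)
  qed measurable
  then have "(\<integral>\<^sup>+y. ennreal (norm (dist x y / 2)) \<partial>\<pi>) < \<infinity>"
    by (simp add: order_le_less_trans[OF _ ennreal_less_top])
  then have "integrable \<pi> (\<lambda>y. dist x y / 2)" by (intro integrableI_bounded) measurable
  then have "integrable \<pi> (\<lambda>y. 2 * (dist x y / 2))" by (rule integrable_mult_right)
  then show ?thesis by simp
qed

lemma integrable_lipschitz: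
  fixes h :: "'a \<Rightarrow> real"
  assumes h: "C-lipschitz_on UNIV h"
  shows "integrable \<pi> h"
proof -
  fix x :: 'a
  note [measurable] = lipschitz_measurable[OF h]
  have "norm (h y) \<le> norm (C * dist x y + \<bar>h x\<bar>)" for y
  proof -
    have "\<bar>h x - h y\<bar> \<le> C * dist x y"
      using lipschitz_onD[OF h, of x y] by (simp add: dist_real_def)
    then show ?thesis by simp
  qed
  then have "AE y in \<pi>. norm (h y) \<le> norm (C * dist x y + \<bar>h x\<bar>)"
    by (rule AE_I2)
  moreover have "integrable \<pi> (\<lambda>y. C * dist x y + \<bar>h x\<bar>)"
    using integrable_dist[of x] by (intro Bochner_Integration.integrable_add integrable_mult_right) simp_all
  moreover have "h \<in> borel_measurable \<pi>" by measurable
  ultimately show ?thesis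
    by (rule Bochner_Integration.integrable_bound[rotated 2])
qed

text \<open>By stationarity P^k g x minus the mean is the average over y of P^k g x - P^k g y, hence
  at most \<open>slope k\<close> times the mean distance to x, which \<open>integrable_dist\<close>
  makes finite.\<close>

lemma avg_tendsto:
  assumes lip: "1-lipschitz_on UNIV g" and bd: "\<And>x. \<bar>g x\<bar> \<le> B"
  shows "(\<lambda>k. avg k g x) \<longlonglongrightarrow> (\<integral>y. g y \<partial>\<pi>)"
proof -
  note [measurable] = lipschitz_measurable[OF lip]
  have "\<bar>avg k g x - (\<integral>y. g y \<partial>\<pi>)\<bar> \<le> slope k * (\<integral>y. dist x y \<partial>\<pi>)" for k
  proof -
    have int: "integrable \<pi> (avg k g)"
      using abs_avg_le[of g B k] bd by (auto intro!: integrable_of_abs_le[where B=B])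
    have "avg k g x - (\<integral>y. g y \<partial>\<pi>) = (\<integral>y. avg k g x - avg k g y \<partial>\<pi>)"
      using int integral_avg[of g B k] bd by (simp add: prob_space)
    also have "\<bar>\<dots>\<bar> \<le> (\<integral>y. slope k * dist x y \<partial>\<pi>)"
      using int integrable_dist[of x] avg_diff_le[OF lip bd]
      by (intro integral_abs_bound[THEN order_trans] integral_mono) auto
    finally show ?thesis by simp
  qed
  then have "\<forall>\<^sub>F k in sequentially. norm (avg k g x - (\<integral>y. g y \<partial>\<pi>)) \<le> slope k * (\<integral>y. dist x y \<partial>\<pi>)"
    by (intro always_eventually allI) (simp only: real_norm_def)
  moreover have "(\<lambda>k. slope k * (\<integral>y. dist x y \<partial>\<pi>)) \<longlonglongrightarrow> 0"
    using tendsto_mult_right[OF slope_tendsto] by simp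
  ultimately have "(\<lambda>k. avg k g x - (\<integral>y. g y \<partial>\<pi>)) \<longlonglongrightarrow> 0"
    by (rule Lim_null_comparison)
  then show ?thesis by (rule LIM_zero_cancel)
qed

section \<open>The exchangeable pair of a stationary step\<close>

definition step_kernel :: "'a \<Rightarrow> ('a \<times> 'a) measure" where
  "step_kernel x = distr (P x) (borel \<Otimes>\<^sub>M borel) (Pair x)"

text \<open>The law of (X, Y), where X has law \<pi> and Y is drawn from P_X.\<close>

definition step_law :: "('a \<times> 'a) measure" where
  "step_law = \<pi> \<bind> step_kernel"

lemma step_kernel_measurable[measurable]:
  "step_kernel \<in> borel \<rightarrow>\<^sub>M prob_algebra (borel \<Otimes>\<^sub>M borel)"
  unfolding step_kernel_def by measurable

lemma step_kernel_pi: "step_kernel \<in> \<pi> \<rightarrow>\<^sub>M prob_algebra (borel \<Otimes>\<^sub>M borel)"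
  using step_kernel_measurable by (simp add: measurable_cong_sets[OF sets_pi refl])

lemma sets_step_law[simp, measurable_cong]: "sets step_law = sets (borel \<Otimes>\<^sub>M borel)"
  unfolding step_law_def
  by (rule sets_bind'[OF _ step_kernel_measurable]) (simp add: space_prob_algebra prob_space_pi)

lemma prob_space_step_law: "prob_space step_law"
  unfolding step_law_def
  by (rule prob_space_bind'[OF _ step_kernel_measurable]) (simp add: space_prob_algebra prob_space_pi)

lemma nn_integral_step_law:
  assumes [measurable]: "G \<in> borel_measurable (borel \<Otimes>\<^sub>M borel)"
  shows "(\<integral>\<^sup>+p. G p \<partial>step_law) = (\<integral>\<^sup>+x. \<integral>\<^sup>+y. G (x, y) \<partial>P x \<partial>\<pi>)"
  unfolding step_law_def
  by (subst nn_integral_bind[OF _ measurable_prob_algebraD[OF step_kernel_pi]])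
    (simp_all add: step_kernel_def nn_integral_distr)

lemma integral_step_law:
  fixes G :: "'a \<times> 'a \<Rightarrow> real"
  assumes [measurable]: "G \<in> borel_measurable (borel \<Otimes>\<^sub>M borel)" and "\<And>p. \<bar>G p\<bar> \<le> B"
  shows "(\<integral>p. G p \<partial>step_law) = (\<integral>x. \<integral>y. G (x, y) \<partial>P x \<partial>\<pi>)"
  unfolding step_law_def
  by (subst integral_bind_prob[OF prob_space_pi step_kernel_pi _ assms(2)])
    (simp_all add: step_kernel_def integral_distr)

lemma swap_measurable[measurable]:
  "prod.swap \<in> (borel :: 'a measure) \<Otimes>\<^sub>M (borel :: 'a measure) \<rightarrow>\<^sub>M borel \<Otimes>\<^sub>M borel"
  unfolding prod.swap_def[abs_def] by measurable

text \<open>On rectangles the symmetry is exactly \<open>reversible\<close>. Rectangles are stable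
  under intersection and generate the product sigma-algebra, so the two finite measures
  agree.\<close>

lemma swap_step_law: "distr step_law (borel \<Otimes>\<^sub>M borel) prod.swap = step_law"
proof (rule measure_eqI_generator_eq[OF Int_stable_pair_measure_generator[of borel borel]])
  let ?E = "{a \<times> b |a b. a \<in> sets (borel :: 'a measure) \<and> b \<in> sets (borel :: 'a measure)}"
  have rect: "emeasure step_law (A \<times> B) = (\<integral>\<^sup>+x\<in>A. emeasure (P x) B \<partial>\<pi>)"
    if [measurable]: "A \<in> sets borel" "B \<in> sets borel" for A B
  proof -
    have "emeasure step_law (A \<times> B) = (\<integral>\<^sup>+p. indicator (A \<times> B) p \<partial>step_law)" by simp
    also have "\<dots> = (\<integral>\<^sup>+x. \<integral>\<^sup>+y. indicator (A \<times> B) (x, y) \<partial>P x \<partial>\<pi>)"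
      by (rule nn_integral_step_law) measurable
    also have "\<dots> = (\<integral>\<^sup>+x. \<integral>\<^sup>+y. indicator A x * indicator B y \<partial>P x \<partial>\<pi>)"
      by (simp add: indicator_times)
    also have "\<dots> = (\<integral>\<^sup>+x\<in>A. emeasure (P x) B \<partial>\<pi>)"
      by (simp add: nn_integral_cmult mult.commute)
    finally show ?thesis .
  qed
  show "?E \<subseteq> Pow (space borel \<times> space borel)" by auto
  show "sets (distr step_law (borel \<Otimes>\<^sub>M borel) prod.swap) = sigma_sets (space borel \<times> space borel) ?E"
    by (simp add: sets_pair_measure)
  show "sets step_law = sigma_sets (space borel \<times> space borel) ?E" by (simp add: sets_pair_measure)
  show "range (\<lambda>_::nat. UNIV \<times> UNIV) \<subseteq> ?E" "(\<Union>i::nat. UNIV \<times> UNIV) = space borel \<times> space borel"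
    by (auto intro!: exI[of _ UNIV])
  interpret S: prob_space step_law by (rule prob_space_step_law)
  show "emeasure (distr step_law (borel \<Otimes>\<^sub>M borel) prod.swap) (UNIV \<times> UNIV) \<noteq> \<infinity>"
    using S.emeasure_space_1 prob_space.emeasure_le_1[OF S.prob_space_distr[of prod.swap "borel \<Otimes>\<^sub>M borel"]]
    by (metis ennreal_one_neq_top infinity_ennreal_def measurable_cong_sets neq_top_trans sets_step_law swap_measurable)
  fix X assume "X \<in> ?E"
  then obtain A B where X: "X = A \<times> B" and [measurable]: "A \<in> sets borel" "B \<in> sets borel" by auto
  have "emeasure (distr step_law (borel \<Otimes>\<^sub>M borel) prod.swap) X = emeasure step_law (B \<times> A)"
    unfolding X by (subst emeasure_distr) (auto intro!: arg_cong[of _ _ "emeasure step_law"]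
      simp: sets_eq_imp_space_eq[OF sets_step_law] space_pair_measure)
  also have "\<dots> = emeasure step_law X"
    unfolding X using reversible by (simp add: rect reversible_def)
  finally show "emeasure (distr step_law (borel \<Otimes>\<^sub>M borel) prod.swap) X = emeasure step_law X" .
qed

lemma nn_integral_step_law_swap:
  assumes "G \<in> borel_measurable (borel \<Otimes>\<^sub>M borel)"
  shows "(\<integral>\<^sup>+p. G (prod.swap p) \<partial>step_law) = (\<integral>\<^sup>+p. G p \<partial>step_law)"
  using assms by (subst (2) swap_step_law[symmetric]) (simp add: nn_integral_distr)

lemma integral_step_law_swap:
  fixes G :: "'a \<times> 'a \<Rightarrow> real"
  assumes "G \<in> borel_measurable (borel \<Otimes>\<^sub>M borel)"
  shows "(\<integral>p. G (prod.swap p) \<partial>step_law) = (\<integral>p. G p \<partial>step_law)"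
  using assms by (subst (2) swap_step_law[symmetric]) (simp add: integral_distr)

text \<open>The left side is the expectation of (h X - h Y) w X over the stationary step.
  Exchangeability makes it also that of (h Y - h X) w Y, and averaging the two gives the symmetric
  product.\<close>

lemma dirichlet_form:
  fixes h w :: "'a \<Rightarrow> real"
  assumes [measurable]: "h \<in> borel_measurable borel" "w \<in> borel_measurable borel"
    and h: "\<And>x. \<bar>h x\<bar> \<le> B" and w: "\<And>x. \<bar>w x\<bar> \<le> C"
  shows "(\<integral>x. (h x - (\<integral>y. h y \<partial>P x)) * w x \<partial>\<pi>)
    = (\<integral>p. (h (fst p) - h (snd p)) * (w (fst p) - w (snd p)) \<partial>step_law) / 2"
proof -
  interpret S: prob_space step_law by (rule prob_space_step_law)
  define G where "G = (\<lambda>p. (h (fst p) - h (snd p)) * w (fst p))"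
  have [measurable]: "G \<in> borel_measurable (borel \<Otimes>\<^sub>M borel)" unfolding G_def by measurable
  have bd: "\<bar>G p\<bar> \<le> (B + B) * C" for p
  proof -
    have "\<bar>h (fst p) - h (snd p)\<bar> \<le> B + B" "0 \<le> B + B"
      using h[of "fst p"] h[of "snd p"] by linarith+
    from mult_mono[OF this(1) w[of "fst p"] this(2)] show ?thesis
      by (simp add: G_def abs_mult)
  qed
  have int: "integrable step_law G" by (intro S.integrable_of_abs_le[where B="(B + B) * C"] bd) measurable
  have int': "integrable step_law (\<lambda>p. G (prod.swap p))"
    by (intro S.integrable_of_abs_le[where B="(B + B) * C"] bd) measurable
  have "(\<integral>p. G p \<partial>step_law) = (\<integral>x. \<integral>y. G (x, y) \<partial>P x \<partial>\<pi>)"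
    by (rule integral_step_law[OF _ bd]) measurable
  also have "\<dots> = (\<integral>x. (h x - (\<integral>y. h y \<partial>P x)) * w x \<partial>\<pi>)"
  proof (rule Bochner_Integration.integral_cong[OF refl])
    fix x
    interpret Q: prob_space "P x" by (rule prob_space_kernel)
    have "integrable (P x) h" using h by (intro Q.integrable_of_abs_le[where B=B]) auto
    then show "(\<integral>y. G (x, y) \<partial>P x) = (h x - (\<integral>y. h y \<partial>P x)) * w x"
      using Q.prob_space by (simp add: G_def)
  qed
  finally have "(\<integral>x. (h x - (\<integral>y. h y \<partial>P x)) * w x \<partial>\<pi>) = (\<integral>p. G p \<partial>step_law)" ..
  also have "\<dots> = (\<integral>p. G p + G (prod.swap p) \<partial>step_law) / 2"
  proof -
    have "(\<integral>p. G p + G (prod.swap p) \<partial>step_law) = (\<integral>p. G p \<partial>step_law) + (\<integral>p. G (prod.swap p) \<partial>step_law)"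
      by (rule Bochner_Integration.integral_add[OF int int'])
    also have "(\<integral>p. G (prod.swap p) \<partial>step_law) = (\<integral>p. G p \<partial>step_law)"
      by (rule integral_step_law_swap) measurable
    finally show ?thesis by linarith
  qed
  also have "(\<lambda>p. G p + G (prod.swap p)) = (\<lambda>p. (h (fst p) - h (snd p)) * (w (fst p) - w (snd p)))"
    by (auto simp: G_def algebra_simps)
  finally show ?thesis .
qed

section \<open>Concentration\<close>

text \<open>The Dirichlet form of the partial sum h of P^k g against w = exp (\<theta> g) gives the
  inequality with g - P^n g in place of g and a right side free of n. As n grows, P^n g tends to the
  mean 0, and dominated convergence finishes.\<close>

lemma tilted_mean_le:
  fixes g V :: "'a \<Rightarrow> real"
  assumes lip: "1-lipschitz_on UNIV g" and bd: "\<And>x. \<bar>g x\<bar> \<le> B" and mean: "(\<integral>x. g x \<partial>\<pi>) = 0"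
    and \<theta>: "0 \<le> \<theta>" and V0: "\<And>x. 0 \<le> V x" and V: "integrable \<pi> V"
    and curv: "\<And>x. (\<integral>\<^sup>+y. curv_sum_at P x y * ennreal ((dist x y)\<^sup>2) \<partial>P x) \<le> ennreal (V x)"
  shows "(\<integral>x. g x * exp (\<theta> * g x) \<partial>\<pi>) \<le> \<theta> / 2 * (\<integral>x. V x * exp (\<theta> * g x) \<partial>\<pi>)"
proof -
  interpret S: prob_space step_law by (rule prob_space_step_law)
  note gm[measurable] = lipschitz_measurable[OF lip]
  define w where "w = (\<lambda>x. exp (\<theta> * g x))"
  have [measurable]: "w \<in> borel_measurable borel" unfolding w_def by measurable
  have wpos: "0 < w x" for x by (simp add: w_def)
  have wbd: "\<bar>w x\<bar> \<le> exp (\<bar>\<theta>\<bar> * B)" for x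
    using exp_mult_le_of_abs_le[OF bd] by (simp add: w_def)
  have intV: "integrable \<pi> (\<lambda>x. V x * w x)"
    unfolding w_def using bd by (intro integrable_mult_exp_of_abs_le[OF V]) simp_all
  have fin: "(\<integral>x. (g x - avg n g x) * w x \<partial>\<pi>) \<le> \<theta> / 2 * (\<integral>x. V x * w x \<partial>\<pi>)" for n
  proof -
    define h where "h = (\<lambda>x. \<Sum>k<n. avg k g x)"
    have [measurable]: "h \<in> borel_measurable borel" unfolding h_def by measurable
    have hbd: "\<bar>h x\<bar> \<le> real n * B" for x
    proof -
      have "\<bar>h x\<bar> \<le> (\<Sum>k<n. \<bar>avg k g x\<bar>)" unfolding h_def by (rule sum_abs)
      also have "\<dots> \<le> (\<Sum>k<n. B)" by (intro sum_mono abs_avg_le gm bd)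
      finally show ?thesis by simp
    qed
    have tele: "h x - (\<integral>y. h y \<partial>P x) = g x - avg n g x" for x
    proof -
      interpret Q: prob_space "P x" by (rule prob_space_kernel)
      have "integrable (P x) (avg k g)" for k
        by (intro Q.integrable_of_abs_le[where B=B] abs_avg_le gm bd) simp_all
      then have "(\<integral>y. h y \<partial>P x) = (\<Sum>k<n. avg (Suc k) g x)"
        unfolding h_def by (simp add: avg_Suc[OF gm bd])
      then have "h x - (\<integral>y. h y \<partial>P x) = (\<Sum>k<n. avg k g x - avg (Suc k) g x)"
        by (simp add: h_def sum_subtractf)
      also have "\<dots> = avg 0 g x - avg n g x" by (rule sum_lessThan_telescope')
      also have "avg 0 g x = g x" by (simp add: avg_def integral_return)
      finally show ?thesis .
    qed
    \<comment> \<open>Of the two distances in the condition on V, one comes from the increment of h,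
      with factor \<open>curv_sum_at P x y\<close>, and the other from the increment of w.\<close>
    define Q where "Q = (\<lambda>x y. \<bar>h x - h y\<bar> * dist x y)"
    have Q_int: "(\<integral>\<^sup>+y. ennreal (Q x y) \<partial>P x) \<le> ennreal (V x)" for x
    proof (rule order_trans[OF nn_integral_mono curv])
      fix y
      have "ennreal (Q x y) = ennreal \<bar>h x - h y\<bar> * ennreal (dist x y)"
        by (simp add: Q_def ennreal_mult)
      also have "\<dots> \<le> curv_sum_at P x y * ennreal (dist x y) * ennreal (dist x y)"
        unfolding h_def by (intro mult_right_mono sum_avg_diff_le[OF lip bd]) simp
      also have "\<dots> = curv_sum_at P x y * ennreal ((dist x y)\<^sup>2)"
        by (simp add: power2_eq_square mult.assoc ennreal_mult)
      finally show "ennreal (Q x y) \<le> curv_sum_at P x y * ennreal ((dist x y)\<^sup>2)" .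
    qed
    define A where "A = \<theta> / 2 * (\<integral>x. V x * w x \<partial>\<pi>)"
    have A0: "0 \<le> A"
      unfolding A_def using \<theta> wpos V0 by (intro mult_nonneg_nonneg integral_nonneg_AE) (auto simp: less_imp_le)
    define E where "E = (\<lambda>p. (h (fst p) - h (snd p)) * (w (fst p) - w (snd p)))"
    define G where "G = (\<lambda>p. \<theta> / 2 * (Q (fst p) (snd p) * w (fst p)))"
    have Q0: "0 \<le> Q x y" for x y by (simp add: Q_def)
    have G0: "0 \<le> G p" for p using \<theta> wpos[of "fst p"] Q0 by (simp add: G_def)
    have [measurable]: "E \<in> borel_measurable (borel \<Otimes>\<^sub>M borel)" unfolding E_def by measurable
    have Gm[measurable]: "G \<in> borel_measurable (borel \<Otimes>\<^sub>M borel)" unfolding G_def Q_def by measurable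
    \<comment> \<open>Splitting the average of w x and w y gives G and its mirror image. These have
      equal integrals by exchangeability, and the resulting 2 cancels the 1/2 of the Dirichlet
      form.\<close>
    have E_le: "\<bar>E p\<bar> \<le> G p + G (prod.swap p)" for p
    proof -
      obtain x y where p: "p = (x, y)" by fastforce
      have "\<bar>w x - w y\<bar> \<le> \<bar>\<theta> * g x - \<theta> * g y\<bar> * (w x + w y) / 2"
        unfolding w_def by (rule abs_exp_diff_le)
      also have "\<bar>\<theta> * g x - \<theta> * g y\<bar> = \<theta> * \<bar>g x - g y\<bar>"
        using \<theta> by (simp add: abs_mult flip: right_diff_distrib)
      also have "\<theta> * \<bar>g x - g y\<bar> * (w x + w y) / 2 \<le> \<theta> * dist x y * (w x + w y) / 2"
        using \<theta> wpos[of x] wpos[of y] lipschitz_onD[OF lip, of x y]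
        by (intro divide_right_mono mult_right_mono mult_left_mono) (simp_all add: dist_real_def)
      finally have "\<bar>h x - h y\<bar> * \<bar>w x - w y\<bar> \<le> \<bar>h x - h y\<bar> * (\<theta> * dist x y * (w x + w y) / 2)"
        by (rule mult_left_mono) simp
      also have "\<dots> = G p + G (prod.swap p)"
        by (simp add: p G_def Q_def dist_commute abs_minus_commute distrib_left add_divide_distrib mult_ac)
      finally show ?thesis by (simp add: p E_def abs_mult)
    qed
    have "ennreal (\<integral>p. E p \<partial>step_law) \<le> (\<integral>\<^sup>+p. ennreal \<bar>E p\<bar> \<partial>step_law)"
    proof (cases "integrable step_law E")
      case True
      then have "ennreal \<bar>\<integral>p. E p \<partial>step_law\<bar> \<le> (\<integral>\<^sup>+p. ennreal \<bar>E p\<bar> \<partial>step_law)"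
        using integral_norm_bound_ennreal[OF True] by simp
      then show ?thesis by (rule order_trans[rotated]) (simp add: ennreal_leI)
    next
      case False
      \<comment> \<open>The Bochner integral of a function that is not integrable is 0.\<close>
      then show ?thesis by (simp add: not_integrable_integral_eq)
    qed
    also have "\<dots> \<le> (\<integral>\<^sup>+p. ennreal (G p) + ennreal (G (prod.swap p)) \<partial>step_law)"
      using E_le G0 by (intro nn_integral_mono) (simp flip: ennreal_plus)
    also have "\<dots> = 2 * (\<integral>\<^sup>+p. ennreal (G p) \<partial>step_law)"
      using nn_integral_step_law_swap[of "\<lambda>p. ennreal (G p)"] by (simp add: nn_integral_add mult_2)
    also have "(\<integral>\<^sup>+p. ennreal (G p) \<partial>step_law) = (\<integral>\<^sup>+x. \<integral>\<^sup>+y. ennreal (G (x, y)) \<partial>P x \<partial>\<pi>)"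
      by (rule nn_integral_step_law) measurable
    also have "\<dots> = (\<integral>\<^sup>+x. ennreal (\<theta> / 2 * w x) * (\<integral>\<^sup>+y. ennreal (Q x y) \<partial>P x) \<partial>\<pi>)"
    proof (rule nn_integral_cong)
      fix x
      have "(\<integral>\<^sup>+y. ennreal (G (x, y)) \<partial>P x) = (\<integral>\<^sup>+y. ennreal (\<theta> / 2 * w x) * ennreal (Q x y) \<partial>P x)"
        using \<theta> wpos[of x] Q0 by (intro nn_integral_cong) (simp add: G_def mult_ac flip: ennreal_mult)
      also have "\<dots> = ennreal (\<theta> / 2 * w x) * (\<integral>\<^sup>+y. ennreal (Q x y) \<partial>P x)"
        by (rule nn_integral_cmult) (simp add: Q_def)
      finally show "(\<integral>\<^sup>+y. ennreal (G (x, y)) \<partial>P x) = ennreal (\<theta> / 2 * w x) * (\<integral>\<^sup>+y. ennreal (Q x y) \<partial>P x)" .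
    qed
    also have "\<dots> \<le> (\<integral>\<^sup>+x. ennreal (\<theta> / 2 * w x) * ennreal (V x) \<partial>\<pi>)"
      by (intro nn_integral_mono mult_left_mono Q_int) simp
    also have "\<dots> = (\<integral>\<^sup>+x. ennreal (\<theta> / 2 * (V x * w x)) \<partial>\<pi>)"
      using \<theta> wpos V0 by (intro nn_integral_cong) (simp add: less_imp_le mult_ac flip: ennreal_mult)
    also have "\<dots> = ennreal A"
      unfolding A_def using \<theta> wpos V0 intV by (subst nn_integral_eq_integral) (auto simp: less_imp_le)
    also have "2 * ennreal A = ennreal (2 * A)"
      using A0 by (simp add: ennreal_mult)
    finally have "ennreal (\<integral>p. E p \<partial>step_law) \<le> ennreal (2 * A)" by (simp add: mult_left_mono)
    then have "(\<integral>p. E p \<partial>step_law) \<le> 2 * A"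
      using A0 by (subst (asm) ennreal_le_iff) simp_all
    moreover have "(\<integral>x. (g x - avg n g x) * w x \<partial>\<pi>) = (\<integral>p. E p \<partial>step_law) / 2"
      using dirichlet_form[of h w, OF _ _ hbd wbd] by (simp add: tele E_def)
    ultimately show ?thesis by (simp add: A_def)
  qed
  have "(\<lambda>n. \<integral>x. (g x - avg n g x) * w x \<partial>\<pi>) \<longlonglongrightarrow> (\<integral>x. g x * w x \<partial>\<pi>)"
  proof (rule integral_dominated_convergence[where w="\<lambda>_. (B + B) * exp (\<bar>\<theta>\<bar> * B)"])
    show "AE x in \<pi>. (\<lambda>n. (g x - avg n g x) * w x) \<longlonglongrightarrow> g x * w x"
    proof (rule AE_I2)
      fix x
      have "(\<lambda>n. (g x - avg n g x) * w x) \<longlonglongrightarrow> (g x - (\<integral>y. g y \<partial>\<pi>)) * w x"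
        by (intro tendsto_intros avg_tendsto[OF lip bd])
      then show "(\<lambda>n. (g x - avg n g x) * w x) \<longlonglongrightarrow> g x * w x" by (simp add: mean)
    qed
    fix n
    show "AE x in \<pi>. norm ((g x - avg n g x) * w x) \<le> (B + B) * exp (\<bar>\<theta>\<bar> * B)"
    proof (rule AE_I2)
      fix x
      have "\<bar>g x - avg n g x\<bar> \<le> B + B" "0 \<le> B + B"
        using bd[of x] abs_avg_le[OF gm bd, of n x] by linarith+
      from mult_mono[OF this(1) wbd[of x] this(2)]
      show "norm ((g x - avg n g x) * w x) \<le> (B + B) * exp (\<bar>\<theta>\<bar> * B)" by (simp add: abs_mult)
    qed
  qed simp_all
  then have "(\<integral>x. g x * w x \<partial>\<pi>) \<le> \<theta> / 2 * (\<integral>x. V x * w x \<partial>\<pi>)"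
    by (rule LIMSEQ_le_const2) (intro exI allI impI fin)
  then show ?thesis by (simp only: w_def)
qed

section \<open>From bounded to arbitrary Lipschitz functions\<close>

text \<open>Truncating f to [-n, n] preserves the Lipschitz constant, and recentring makes the
  hypothesis applicable with the same C for every n. Integrability of f makes the truncated means
  converge, and Fatou's lemma passes to the limit.\<close>

lemma mgf_le_of_bounded:
  fixes f :: "'a \<Rightarrow> real"
  assumes lip: "1-lipschitz_on UNIV f"
    and bounded: "\<And>g B. 1-lipschitz_on UNIV g \<Longrightarrow> (\<And>x. \<bar>g x\<bar> \<le> B) \<Longrightarrow> (\<integral>x. g x \<partial>\<pi>) = 0
      \<Longrightarrow> (\<integral>x. exp (\<theta> * g x) \<partial>\<pi>) \<le> C"
  shows "(\<integral>\<^sup>+x. ennreal (exp (\<theta> * (f x - (\<integral>z. f z \<partial>\<pi>)))) \<partial>\<pi>) \<le> ennreal C"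
proof -
  define F where "F = (\<lambda>n x. max (- real n) (min (real n) (f x)))"
  define G where "G = (\<lambda>n x. F n x - (\<integral>z. F n z \<partial>\<pi>))"
  note fm[measurable] = lipschitz_measurable[OF lip]
  have F_lip: "1-lipschitz_on UNIV (F n)" for n
  proof (rule lipschitz_onI)
    fix x y
    have "\<bar>F n x - F n y\<bar> \<le> \<bar>f x - f y\<bar>" by (auto simp: F_def max_def min_def abs_le_iff)
    also have "\<dots> \<le> dist x y" using lipschitz_onD[OF lip, of x y] by (simp add: dist_real_def)
    finally show "dist (F n x) (F n y) \<le> 1 * dist x y" by (simp add: dist_real_def)
  qed simp
  note Fm[measurable] = lipschitz_measurable[OF F_lip]
  have F_bd: "\<bar>F n x\<bar> \<le> real n" for n x by (auto simp: F_def)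
  have F_int: "integrable \<pi> (F n)" for n by (intro integrable_of_abs_le[of _ "real n"] F_bd) measurable
  have G_lip: "1-lipschitz_on UNIV (G n)" for n
    using F_lip[of n] by (auto simp: G_def lipschitz_on_def dist_real_def)
  note Gm[measurable] = lipschitz_measurable[OF G_lip]
  have G_bd: "\<bar>G n x\<bar> \<le> real n + \<bar>\<integral>z. F n z \<partial>\<pi>\<bar>" for n x
    using F_bd[of n x] by (simp add: G_def)
  have G_mean: "(\<integral>x. G n x \<partial>\<pi>) = 0" for n using F_int[of n] by (simp add: G_def)
  have F_lim: "(\<lambda>n. F n x) \<longlonglongrightarrow> f x" for x
  proof (rule tendsto_eventually)
    obtain N where N: "\<bar>f x\<bar> \<le> real N" using real_arch_simple by blast
    show "\<forall>\<^sub>F n in sequentially. F n x = f x"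
    proof (rule eventually_sequentiallyI[of N])
      fix n assume "N \<le> n"
      then have "real N \<le> real n" by simp
      with N have "\<bar>f x\<bar> \<le> real n" by linarith
      then show "F n x = f x" by (auto simp: F_def)
    qed
  qed
  have "(\<lambda>n. \<integral>x. F n x \<partial>\<pi>) \<longlonglongrightarrow> (\<integral>x. f x \<partial>\<pi>)"
  proof (rule integral_dominated_convergence[where w="\<lambda>x. \<bar>f x\<bar>"])
    show "integrable \<pi> (\<lambda>x. \<bar>f x\<bar>)" using integrable_lipschitz[OF lip] by simp
    show "AE x in \<pi>. (\<lambda>n. F n x) \<longlonglongrightarrow> f x" using F_lim by simp
    show "AE x in \<pi>. norm (F n x) \<le> \<bar>f x\<bar>" for n by (intro AE_I2) (auto simp: F_def)
  qed simp_all
  then have G_lim: "(\<lambda>n. G n x) \<longlonglongrightarrow> f x - (\<integral>z. f z \<partial>\<pi>)" for x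
    unfolding G_def by (intro tendsto_diff F_lim)
  show ?thesis
  proof (rule nn_integral_fatou_le)
    fix n
    have "(\<integral>\<^sup>+x. ennreal (exp (\<theta> * G n x)) \<partial>\<pi>) = ennreal (\<integral>x. exp (\<theta> * G n x) \<partial>\<pi>)"
      using G_bd by (intro nn_integral_eq_integral integrable_exp_of_abs_le) auto
    also have "\<dots> \<le> ennreal C" by (intro ennreal_leI bounded[OF G_lip G_bd G_mean])
    finally show "(\<integral>\<^sup>+x. ennreal (exp (\<theta> * G n x)) \<partial>\<pi>) \<le> ennreal C" .
  qed (use G_lim in \<open>auto intro!: tendsto_intros\<close>)
qed

lemma mgf_bounded_le:
  fixes g :: "'a \<Rightarrow> real"
  assumes lip: "1-lipschitz_on UNIV g" and bd: "\<And>x. \<bar>g x\<bar> \<le> B"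
    and "0 \<le> T"
    and le: "\<And>\<theta>. 0 \<le> \<theta> \<Longrightarrow> \<theta> \<le> T \<Longrightarrow>
      (\<integral>x. g x * exp (\<theta> * g x) \<partial>\<pi>) \<le> 2 * v * \<theta> * (\<integral>x. exp (\<theta> * g x) \<partial>\<pi>)"
  shows "(\<integral>x. exp (T * g x) \<partial>\<pi>) \<le> exp (v * T\<^sup>2)"
  using lipschitz_measurable[OF lip] bd
  by (intro gaussian_growth[OF \<open>0 \<le> T\<close> mgf_has_derivative le]) simp_all

text \<open>For V constantly c the differential inequality reads m' \<le> (c/2) \<theta> m, which
  integrates to the factor c/4.\<close>

lemma mgf_le_const:
  fixes f :: "'a \<Rightarrow> real"
  assumes lip: "1-lipschitz_on UNIV f" and \<theta>: "0 \<le> \<theta>" and c: "0 \<le> c"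
    and curv: "\<And>x. (\<integral>\<^sup>+y. curv_sum_at P x y * ennreal ((dist x y)\<^sup>2) \<partial>P x) \<le> ennreal c"
  shows "(\<integral>\<^sup>+x. ennreal (exp (\<theta> * (f x - (\<integral>z. f z \<partial>\<pi>)))) \<partial>\<pi>) \<le> ennreal (exp (c / 4 * \<theta>\<^sup>2))"
proof (rule mgf_le_of_bounded[OF lip])
  fix g :: "'a \<Rightarrow> real" and B
  assume g: "1-lipschitz_on UNIV g" "\<And>x. \<bar>g x\<bar> \<le> B" "(\<integral>x. g x \<partial>\<pi>) = 0"
  show "(\<integral>x. exp (\<theta> * g x) \<partial>\<pi>) \<le> exp (c / 4 * \<theta>\<^sup>2)"
  proof (rule mgf_bounded_le[OF g(1,2) \<theta>])
    fix \<tau> :: real assume "0 \<le> \<tau>"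
    from tilted_mean_le[OF g this, of "\<lambda>_. c"] c curv
    show "(\<integral>x. g x * exp (\<tau> * g x) \<partial>\<pi>) \<le> 2 * (c / 4) * \<tau> * (\<integral>x. exp (\<tau> * g x) \<partial>\<pi>)"
      by (simp add: mult.commute mult.left_commute)
  qed
qed

section \<open>Gaussian and self-bounded moment estimates\<close>

definition kappa :: real where
  "kappa = enn2real (curv_sum P)"

text \<open>The constant \<open>kappa * sigma2\<close> is an admissible V: the local curvature sum
  is at most the global one, and what remains is the mean square jump.\<close>

lemma curv_jump_le:
  "(\<integral>\<^sup>+y. curv_sum_at P x y * ennreal ((dist x y)\<^sup>2) \<partial>P x) \<le> ennreal (kappa * sigma2)"
proof -
  have "curv_sum P = ennreal kappa" using curv_sum_finite by (simp add: kappa_def)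
  then have "(\<integral>\<^sup>+y. curv_sum_at P x y * ennreal ((dist x y)\<^sup>2) \<partial>P x)
      \<le> (\<integral>\<^sup>+y. ennreal kappa * ennreal ((dist x y)\<^sup>2) \<partial>P x)"
    using curv_sum_at_le[of x] by (intro nn_integral_mono mult_right_mono) simp_all
  also have "\<dots> = ennreal kappa * (\<integral>\<^sup>+y. ennreal ((dist x y)\<^sup>2) \<partial>P x)"
    by (rule nn_integral_cmult) simp
  also have "\<dots> \<le> ennreal kappa * ennreal sigma2"
    by (intro mult_left_mono jump_square_le) simp
  also have "\<dots> = ennreal (kappa * sigma2)"
    by (simp add: kappa_def sigma2_def ennreal_mult)
  finally show ?thesis .
qed

lemmas mgf_le = mgf_le_const[OF _ _ _ curv_jump_le]

text \<open>The one-sided tail is applied to f and to -f, hence a moment bound for every 1-Lipschitz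
  h.\<close>

lemma two_sided_tail_of_mgf:
  fixes f :: "'a \<Rightarrow> real"
  assumes lip: "1-lipschitz_on UNIV f" and "0 \<le> v" "0 \<le> c" "0 \<le> t"
    and mgf: "\<And>h \<theta>. 1-lipschitz_on UNIV h \<Longrightarrow> 0 \<le> \<theta> \<Longrightarrow> 2 * c * \<theta> \<le> 1 \<Longrightarrow>
      (\<integral>\<^sup>+x. ennreal (exp (\<theta> * (h x - (\<integral>z. h z \<partial>\<pi>)))) \<partial>\<pi>) \<le> ennreal (exp (v * \<theta>\<^sup>2))"
  shows "\<P>(x in \<pi>. \<bar>f x - (\<integral>z. f z \<partial>\<pi>)\<bar> \<ge> t) \<le> 2 * exp (- (t\<^sup>2 / (4 * v + 4 * c * t)))"
proof (rule two_sided_tail)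
  note [measurable] = lipschitz_measurable[OF lip]
  show "(\<lambda>x. f x - (\<integral>z. f z \<partial>\<pi>)) \<in> borel_measurable \<pi>" by measurable
  show "\<P>(x in \<pi>. t \<le> f x - (\<integral>z. f z \<partial>\<pi>)) \<le> exp (- (t\<^sup>2 / (4 * v + 4 * c * t)))"
    by (rule subgamma_tail[OF _ assms(2-4) mgf[OF lip]]) measurable
  have "1-lipschitz_on UNIV (\<lambda>x. - f x)"
    using lip by (simp add: lipschitz_on_def dist_minus)
  from mgf[OF this] have "\<P>(x in \<pi>. t \<le> - f x - (\<integral>z. - f z \<partial>\<pi>)) \<le> exp (- (t\<^sup>2 / (4 * v + 4 * c * t)))"
    by (intro subgamma_tail assms(2-4)) measurable
  then show "\<P>(x in \<pi>. t \<le> - (f x - (\<integral>z. f z \<partial>\<pi>))) \<le> exp (- (t\<^sup>2 / (4 * v + 4 * c * t)))"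
    by simp
qed


text \<open>V is itself Lipschitz, so the Gaussian estimate bounds its exponential moment. The
  tilted mean of V is then bounded through Gibbs' inequality by m' itself, and for small \<theta>
  that m' can be absorbed on the left.\<close>

lemma mgf_le_self_bounded:
  fixes f V :: "'a \<Rightarrow> real"
  assumes lip: "1-lipschitz_on UNIV f" and V0: "\<And>x. 0 \<le> V x"
    and V: "lv-lipschitz_on UNIV V" "0 < lv"
    and curv: "\<And>x. (\<integral>\<^sup>+y. curv_sum_at P x y * ennreal ((dist x y)\<^sup>2) \<partial>P x) \<le> ennreal (V x)"
    and L: "0 < L" "lv\<^sup>2 * sigma2 * kappa * L = 8 * (\<integral>x. V x \<partial>\<pi>)"
    and \<theta>: "0 \<le> \<theta>" "4 * \<theta>\<^sup>2 \<le> L"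
  shows "(\<integral>\<^sup>+x. ennreal (exp (\<theta> * (f x - (\<integral>z. f z \<partial>\<pi>)))) \<partial>\<pi>)
    \<le> ennreal (exp ((\<integral>x. V x \<partial>\<pi>) * \<theta>\<^sup>2))"
proof -
  define v where "v = (\<integral>x. V x \<partial>\<pi>)"
  have v0: "0 \<le> v" unfolding v_def using V0 by (intro integral_nonneg_AE) auto
  note [measurable] = lipschitz_measurable[OF V(1)]
  have intV: "integrable \<pi> V" by (rule integrable_lipschitz[OF V(1)])
  have "(\<integral>\<^sup>+x. ennreal (exp (L * V x)) \<partial>\<pi>) \<le> ennreal (exp (3 * L * v))"
  proof -
    have scaled: "1-lipschitz_on UNIV (\<lambda>x. V x / lv)"
    proof (rule lipschitz_onI)
      fix x y
      have "\<bar>V x - V y\<bar> \<le> lv * dist x y"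
        using lipschitz_onD[OF V(1), of x y] by (simp add: dist_real_def)
      then show "dist (V x / lv) (V y / lv) \<le> 1 * dist x y"
        using \<open>0 < lv\<close> by (simp add: dist_real_def pos_divide_le_eq mult.commute flip: diff_divide_distrib)
    qed simp
    have "(\<integral>\<^sup>+x. ennreal (exp (L * V x)) \<partial>\<pi>)
        = (\<integral>\<^sup>+x. ennreal (exp (L * v)) * ennreal (exp ((L * lv) * (V x / lv - v / lv))) \<partial>\<pi>)"
      using \<open>0 < lv\<close> by (intro nn_integral_cong) (simp add: right_diff_distrib flip: ennreal_mult exp_add)
    also have "\<dots> = ennreal (exp (L * v)) * (\<integral>\<^sup>+x. ennreal (exp ((L * lv) * (V x / lv - v / lv))) \<partial>\<pi>)"
      by (rule nn_integral_cmult) measurable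
    also have "\<dots> \<le> ennreal (exp (L * v)) * ennreal (exp (kappa * sigma2 / 4 * (L * lv)\<^sup>2))"
      using mgf_le[OF scaled, of "L * lv"] L(1) V(2)
      by (intro mult_left_mono) (simp_all add: v_def kappa_def sigma2_def)
    \<comment> \<open>The factor 8 in L is used here: the Gaussian exponent of V / lv at L lv
      becomes 2 L v. Undoing the centring adds L v, for a total of 3 L v.\<close>
    also have "kappa * sigma2 / 4 * (L * lv)\<^sup>2 = 2 * L * v"
      using L(2) by (simp add: v_def[symmetric] power2_eq_square) (simp add: field_simps)
    also have "ennreal (exp (L * v)) * ennreal (exp (2 * L * v)) = ennreal (exp (3 * L * v))"
      by (simp flip: ennreal_mult exp_add)
    finally show ?thesis .
  qed
  moreover from this have eV: "integrable \<pi> (\<lambda>x. exp (L * V x))"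
    by (intro integrableI_bounded) (auto simp: order_le_less_trans[OF _ ennreal_less_top])
  ultimately have Z: "(\<integral>x. exp (L * V x) \<partial>\<pi>) \<le> exp (3 * L * v)"
    by (simp add: nn_integral_eq_integral)
  show ?thesis
    unfolding v_def[symmetric]
  proof (rule mgf_le_of_bounded[OF lip])
    fix g :: "'a \<Rightarrow> real" and B
    assume g: "1-lipschitz_on UNIV g" "\<And>x. \<bar>g x\<bar> \<le> B" "(\<integral>x. g x \<partial>\<pi>) = 0"
    note gm[measurable] = lipschitz_measurable[OF g(1)]
    show "(\<integral>x. exp (\<theta> * g x) \<partial>\<pi>) \<le> exp (v * \<theta>\<^sup>2)"
    proof (rule mgf_bounded_le[OF g(1,2) \<theta>(1)])
      fix \<tau> :: real assume \<tau>: "0 \<le> \<tau>" "\<tau> \<le> \<theta>"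
      define m where "m = (\<integral>x. exp (\<tau> * g x) \<partial>\<pi>)"
      define m' where "m' = (\<integral>x. g x * exp (\<tau> * g x) \<partial>\<pi>)"
      define I where "I = (\<integral>x. V x * exp (\<tau> * g x) \<partial>\<pi>)"
      have m: "1 \<le> m" unfolding m_def using g by (intro one_le_mgf) auto
      have I: "m' \<le> \<tau> / 2 * I"
        unfolding m'_def I_def by (rule tilted_mean_le[OF g \<tau>(1) V0 intV curv])
      have "L * I \<le> 3 * L * v * m + \<tau> * m' - m * ln m"
        unfolding m_def m'_def I_def using g by (intro exponential_tilt_le[OF _ _ intV eV Z]) auto
      \<comment> \<open>Here m ln m is nonnegative, as m \<ge> 1 for centred g.\<close>
      also have "\<dots> \<le> 3 * L * v * m + \<tau> * m'" using m by simp
      finally have "\<tau> * (L * I) \<le> \<tau> * (3 * L * v * m + \<tau> * m')"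
        using \<tau>(1) by (rule mult_left_mono)
      moreover have "2 * L * m' \<le> \<tau> * (L * I)"
        using mult_left_mono[OF I, of "2 * L"] L(1) by (simp add: mult_ac)
      \<comment> \<open>The derivative m' stands on both sides, and its occurrence on the right is
        absorbed.\<close>
      ultimately have *: "(2 * L - \<tau>\<^sup>2) * m' \<le> 3 * L * \<tau> * v * m"
        by (simp add: algebra_simps power2_eq_square)
      have "\<tau>\<^sup>2 \<le> \<theta>\<^sup>2" using \<tau> by (intro power_mono) auto
      then have \<tau>2: "4 * \<tau>\<^sup>2 \<le> L" using \<theta>(2) by linarith
      show "m' \<le> 2 * v * \<tau> * m"
      proof (cases "0 \<le> m'")
        case True
        \<comment> \<open>From 4 \<tau>^2 \<le> L the coefficient is at least 7 L / 4. The smaller 3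
          L / 2 is enough to reach the constant 2 v.\<close>
        then have "3 / 2 * L * m' \<le> (2 * L - \<tau>\<^sup>2) * m'"
          using \<tau>2 L(1) by (intro mult_right_mono) auto
        also note *
        also have "3 * L * \<tau> * v * m = 3 / 2 * L * (2 * v * \<tau> * m)" by simp
        finally show ?thesis using L(1) by (subst (asm) mult_le_cancel_left_pos) simp_all
      next
        case False
        moreover have "0 \<le> 2 * v * \<tau> * m" using v0 \<tau>(1) m by simp
        ultimately show ?thesis by linarith
      qed
    qed
  qed
qed

end

section \<open>The Lipschitz coefficient and the two tail bounds\<close>

text \<open>Any Lipschitz constant bounds the difference quotients, so the supremum is a true upper
  bound for them. A pair of distinct points shows that it is nonnegative.\<close>

lemma lipschitz_lip_coeff:
  fixes V :: "'a::metric_space \<Rightarrow> real"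
  assumes two: "\<exists>x y :: 'a. x \<noteq> y" and C: "C-lipschitz_on UNIV V"
  shows "(lip_coeff V)-lipschitz_on UNIV V"
proof -
  have "\<bar>V x - V y\<bar> / dist x y \<le> C" if "x \<noteq> y" for x y
    using lipschitz_onD[OF C, of x y] that by (simp add: dist_real_def pos_divide_le_eq)
  then have bdd: "bdd_above ((\<lambda>(x, y). \<bar>V x - V y\<bar> / dist x y) ` {(x, y). x \<noteq> y})"
    by (intro bdd_aboveI[of _ C]) auto
  have le: "\<bar>V x - V y\<bar> / dist x y \<le> lip_coeff V" if "x \<noteq> y" for x y
    unfolding lip_coeff_def using cSUP_upper[OF _ bdd, of "(x, y)"] that by simp
  show ?thesis
  proof (rule lipschitz_onI)
    show "dist (V x) (V y) \<le> lip_coeff V * dist x y" for x y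
      using le[of x y] by (cases "x = y") (simp_all add: dist_real_def pos_divide_le_eq)
    obtain x y :: 'a where "x \<noteq> y" using two by blast
    then show "0 \<le> lip_coeff V"
      using le[of x y] by (metis abs_ge_zero order_trans zero_le_dist divide_nonneg_nonneg)
  qed
qed

theorem theorem3p15:
  fixes P :: "'a::polish_space \<Rightarrow> 'a measure" and \<pi> :: "'a measure" and f :: "'a \<Rightarrow> real"
  assumes two_points: "\<exists>x y :: 'a. x \<noteq> y"
    and kernel: "P \<in> borel \<rightarrow>\<^sub>M prob_algebra borel"
    and stationary: "stationary P \<pi>"
    and W1_finite: "\<And>x. W1 (return borel x) (P x) < \<infinity>"
    and reversible: "reversible P \<pi>"
    and integral_finite:
      "AE x in \<pi>. (\<integral>\<^sup>+y. ennreal (dist x y) * curv_sum_at P x y \<partial>P x) < \<infinity>"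
    and f_Lipschitz: "1-lipschitz_on UNIV f"
  shows "curv_sum P < \<infinity> \<and> jump_max P < \<infinity> \<longrightarrow>
    (\<forall>t\<ge>0. \<P>(x in \<pi>. \<bar>f x - (\<integral>z. f z \<partial>\<pi>)\<bar> \<ge> t)
        \<le> 2 * exp (- (t\<^sup>2 / (enn2real (curv_sum P) * (enn2real (jump_max P))\<^sup>2)))) \<and>
    (\<forall>V :: 'a \<Rightarrow> real.
        (\<forall>x. 0 \<le> V x) \<and> (\<exists>C. C-lipschitz_on UNIV V) \<and>
        (\<forall>x. (\<integral>\<^sup>+y. curv_sum_at P x y * ennreal ((dist x y)\<^sup>2) \<partial>P x) \<le> ennreal (V x)) \<and>
        L_const P \<pi> V \<noteq> 0 \<longrightarrow>
        (\<forall>t\<ge>0. \<P>(x in \<pi>. \<bar>f x - (\<integral>z. f z \<partial>\<pi>)\<bar> \<ge> t)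
          \<le> 2 * exp (- (t\<^sup>2 / (4 * (\<integral>x. V x \<partial>\<pi>) + 4 * inv_sqrt (L_const P \<pi> V) * t)))))"
proof (intro impI conjI allI; (elim conjE exE)?)
  assume "curv_sum P < \<infinity>" "jump_max P < \<infinity>"
  then interpret reversible_kernel P \<pi>
    using kernel stationary reversible by unfold_locales auto
  fix t :: real assume t: "0 \<le> t"
  have ks: "0 \<le> kappa * sigma2" by (simp add: kappa_def sigma2_def)
  \<comment> \<open>Part (i) is the sub-gamma tail with c = 0 and v a quarter of
    \<open>kappa * sigma2\<close>.\<close>
  have "\<P>(x in \<pi>. \<bar>f x - (\<integral>z. f z \<partial>\<pi>)\<bar> \<ge> t) \<le> 2 * exp (- (t\<^sup>2 / (4 * (kappa * sigma2 / 4) + 4 * 0 * t)))"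
    using ks t by (intro two_sided_tail_of_mgf[OF f_Lipschitz] mgf_le) simp_all
  then show "\<P>(x in \<pi>. \<bar>f x - (\<integral>z. f z \<partial>\<pi>)\<bar> \<ge> t)
      \<le> 2 * exp (- (t\<^sup>2 / (enn2real (curv_sum P) * (enn2real (jump_max P))\<^sup>2)))"
    by (simp add: kappa_def sigma2_def)
next
  assume "curv_sum P < \<infinity>" "jump_max P < \<infinity>"
  then interpret reversible_kernel P \<pi>
    using kernel stationary reversible by unfold_locales auto
  fix V :: "'a \<Rightarrow> real" and t C :: real
  assume t: "0 \<le> t" and V0: "\<forall>x. 0 \<le> V x" and C: "C-lipschitz_on UNIV V"
    and curv: "\<forall>x. (\<integral>\<^sup>+y. curv_sum_at P x y * ennreal ((dist x y)\<^sup>2) \<partial>P x) \<le> ennreal (V x)"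
    and L_nz: "L_const P \<pi> V \<noteq> 0"
  define v where "v = (\<integral>x. V x \<partial>\<pi>)"
  define l where "l = lip_coeff V"
  define c where "c = inv_sqrt (L_const P \<pi> V)"
  have v0: "0 \<le> v" unfolding v_def using V0 by (intro integral_nonneg_AE) auto
  have lip: "l-lipschitz_on UNIV V"
    unfolding l_def by (rule lipschitz_lip_coeff[OF two_points C])
  have c0: "0 \<le> c" by (simp add: c_def inv_sqrt_def)
  show "\<P>(x in \<pi>. \<bar>f x - (\<integral>z. f z \<partial>\<pi>)\<bar> \<ge> t)
      \<le> 2 * exp (- (t\<^sup>2 / (4 * (\<integral>x. V x \<partial>\<pi>) + 4 * inv_sqrt (L_const P \<pi> V) * t)))"
    unfolding v_def[symmetric] c_def[symmetric]
  proof (rule two_sided_tail_of_mgf[OF f_Lipschitz v0 c0 t])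
    fix h :: "'a \<Rightarrow> real" and \<theta> :: real
    assume h: "1-lipschitz_on UNIV h" and \<theta>: "0 \<le> \<theta>" "2 * c * \<theta> \<le> 1"
    show "(\<integral>\<^sup>+x. ennreal (exp (\<theta> * (h x - (\<integral>z. h z \<partial>\<pi>)))) \<partial>\<pi>) \<le> ennreal (exp (v * \<theta>\<^sup>2))"
    proof (cases "l = 0")
      case True
      \<comment> \<open>A zero coefficient makes V constant, and the Gaussian estimate then holds
        for every \<theta> \<ge> 0, with v / 4 in place of v.\<close>
      have "V x = V y" for x y
        using lipschitz_onD[OF lip, of x y] True by simp
      then have "V x = v" for x
      proof -
        have "v = (\<integral>y. V x \<partial>\<pi>)" unfolding v_def
          using \<open>\<And>x y. V x = V y\<close> by (intro Bochner_Integration.integral_cong) auto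
        then show ?thesis by simp
      qed
      then have "(\<integral>\<^sup>+x. ennreal (exp (\<theta> * (h x - (\<integral>z. h z \<partial>\<pi>)))) \<partial>\<pi>) \<le> ennreal (exp (v / 4 * \<theta>\<^sup>2))"
        using curv by (intro mgf_le_const[OF h \<theta>(1) v0]) simp
      also have "\<dots> \<le> ennreal (exp (v * \<theta>\<^sup>2))"
        using v0 by (intro ennreal_leI) (simp add: mult_right_mono)
      finally show ?thesis .
    next
      case False
      then have l: "0 < l" using lipschitz_on_nonneg[OF lip] by simp
      define L where "L = 8 * v / (l\<^sup>2 * sigma2 * kappa)"
      have L_eq: "L_const P \<pi> V = ereal L"
        using False by (simp add: L_const_def L_def v_def l_def sigma2_def kappa_def)
      have "L \<noteq> 0" using L_nz by (simp add: L_eq)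
      moreover have "0 \<le> L" using v0 by (simp add: L_def sigma2_def kappa_def)
      ultimately have L: "0 < L" by simp
      \<comment> \<open>A zero denominator would make the quotient L equal to 0.\<close>
      have den: "l\<^sup>2 * sigma2 * kappa \<noteq> 0" using \<open>L \<noteq> 0\<close> by (auto simp: L_def)
      have "c = L powr (- (1 / 2))" by (simp add: c_def L_eq inv_sqrt_def)
      also have "\<dots> = 1 / sqrt L" using L by (simp only: powr_minus_divide powr_half_sqrt less_imp_le)
      \<comment> \<open>The range 2 c \<theta> \<le> 1 of the tail bound is exactly the range 4
        \<theta>^2 \<le> L of the self-bounded estimate.\<close>
      finally have "2 * \<theta> \<le> sqrt L" using \<theta>(2) L by (simp add: pos_divide_le_eq)
      then have "(2 * \<theta>)\<^sup>2 \<le> (sqrt L)\<^sup>2" using \<theta>(1) by (intro power_mono) auto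
      then have "4 * \<theta>\<^sup>2 \<le> L" using L by (simp add: power_mult_distrib)
      moreover have "l\<^sup>2 * sigma2 * kappa * L = 8 * (\<integral>x. V x \<partial>\<pi>)"
        using den by (simp add: L_def v_def)
      ultimately show ?thesis
        unfolding v_def using V0 curv by (intro mgf_le_self_bounded[OF h _ lip l _ L _ \<theta>(1)]) auto
    qed
  qed
qed

end
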